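(* For $n\ge1$ and $1\le i\le n$ let $D_{n,i}$ be the length of the $i$-th block in a uniformly random game with $n$ pairs of cards. Then, for any fixed positive integer $k$, as $n\to\infty$, $$\left(\frac{D_{n,1}}{2\sqrt n},\dots,\frac{D_{n,k}}{2\sqrt n}\right)\stackrel{d}{\longrightarrow}(X_1,\dots,X_k),$$ where the joint density function of $(X_1,\dots,X_k)$ is given by $$f(x_1,\dots,x_k)=\begin{cases}2^k\,x_1(x_1+x_2)\cdots(x_1+\cdots+x_k)\,e^{-(x_1+\cdots+x_k)^2} & \text{if } x_1,\dots,x_k\ge0,\\ 0 & \text{otherwise.}\end{cases}$$
   Context: Cards and games: there are $n$ labels $1,\dots,n$, and for each label two cards, a blue copy and a red copy. A game with $n$ pairs of cards is an arrangement (permutation) of these $2n$ cards in a row, from left to right, such that for each label the blue card precedes the red card with the same label. $\mathcal{T}_n$ is the set of all such arrangements, so $|\mathcal{T}_n|=(2n)!/2^n$. A (uniformly) random game is a uniformly random element of $\mathcal{T}_n$. Blocks: the red cards partition an arrangement into $n$ disjoint blocks of consecutive cards; for $1\le i\le n$ the $i$-th block ends with the $i$-th red card from the left (the first block starts at the first card, and the $i$-th block for $i\ge 2$ starts right after the $(i-1)$-st red card). The length of a block is the number of cards it contains. $\stackrel{d}{\to}$ denotes convergence in distribution. *)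

theory Defs
  imports "HOL-Probability.Probability" "HOL-Combinatorics.Multiset_Permutations"
begin

datatype colour = Blue | Red

type_synonym card = "nat \<times> colour"

definition precedes :: "'a list \<Rightarrow> 'a \<Rightarrow> 'a \<Rightarrow> bool" where
  "precedes xs a b \<longleftrightarrow> (\<exists>i j. i < j \<and> j < length xs \<and> xs ! i = a \<and> xs ! j = b)"

definition games :: "nat \<Rightarrow> card list set" where
  "games n = {xs \<in> permutations_of_set ({1..n} \<times> {Blue, Red}).
                \<forall>l\<in>{1..n}. precedes xs (l, Blue) (l, Red)}"

definition random_game :: "nat \<Rightarrow> card list pmf" where
  "random_game n = pmf_of_set (games n)"

text \<open>Positions are counted from 1, in increasing order.\<close>

definition red_positions :: "card list \<Rightarrow> nat list" where
  "red_positions xs = filter (\<lambda>p. snd (xs ! (p - 1)) = Red) [1..<Suc (length xs)]"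

text \<open>With the extra entry 0 in front, entry \<open>i\<close> of \<open>0 # red_positions xs\<close> is the position of the
  \<open>i\<close>-th red card for \<open>i \<ge> 1\<close>, so the \<open>i\<close>-th block occupies the positions after entry \<open>i - 1\<close> up to
  and including entry \<open>i\<close>. This is meaningful only for \<open>1 \<le> i \<le> n\<close> in a game with \<open>n\<close> pairs.\<close>

definition block :: "card list \<Rightarrow> nat \<Rightarrow> card list" where
  "block xs i = (let r = 0 # red_positions xs in take (r ! i - r ! (i - 1)) (drop (r ! (i - 1)) xs))"

definition block_length :: "card list \<Rightarrow> nat \<Rightarrow> nat" where
  "block_length xs i = length (block xs i)"

text \<open>Vectors in \<open>\<real>\<^sup>k\<close> are extensional functions on \<open>{1..k}\<close>.\<close>

definition scaled_block_lengths :: "nat \<Rightarrow> nat \<Rightarrow> card list \<Rightarrow> (nat \<Rightarrow> real)" where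
  "scaled_block_lengths k n xs = (\<lambda>i\<in>{1..k}. real (block_length xs i) / (2 * sqrt (real n)))"

abbreviation lebesgue_product :: "nat \<Rightarrow> (nat \<Rightarrow> real) measure" where
  "lebesgue_product k \<equiv> PiM {1..k} (\<lambda>_. lborel)"

definition limit_density :: "nat \<Rightarrow> (nat \<Rightarrow> real) \<Rightarrow> real" where
  "limit_density k x =
     (if \<forall>i\<in>{1..k}. 0 \<le> x i
      then 2 ^ k * (\<Prod>j=1..k. \<Sum>i=1..j. x i) * exp (- (\<Sum>i=1..k. x i)\<^sup>2)
      else 0)"

text \<open>Convergence in distribution of random variables \<open>X n\<close> on \<open>M n\<close> to \<open>Y\<close> on \<open>N\<close>, with values in
  the space \<open>T\<close>, by bounded continuous test functions; the library's \<open>weak_conv_m\<close> covers only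
  real-valued random variables.\<close>

definition converges_in_distribution ::
  "'c topology \<Rightarrow> (nat \<Rightarrow> 'a measure) \<Rightarrow> (nat \<Rightarrow> 'a \<Rightarrow> 'c) \<Rightarrow> 'b measure \<Rightarrow> ('b \<Rightarrow> 'c) \<Rightarrow> bool" where
  "converges_in_distribution T M X N Y \<longleftrightarrow>
     (\<forall>g. continuous_map T euclideanreal g \<and> bounded (g ` topspace T) \<longrightarrow>
        (\<lambda>n. \<integral>\<omega>. g (X n \<omega>) \<partial>M n) \<longlonglongrightarrow> (\<integral>\<omega>. g (Y \<omega>) \<partial>N))"

text \<open>\<open>pmf_of_set\<close> is the uniform distribution only on finite nonempty sets.\<close>

lemma finite_games: "finite (games n)"
  unfolding games_def by (rule finite_subset[of _ "permutations_of_set ({1..n} \<times> {Blue, Red})"]) auto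

lemma games_nonempty: "games n \<noteq> {}"
proof -
  have "\<exists>xs. xs \<in> games n"
  proof (induction n)
    case 0
    have "[] \<in> games 0" by (simp add: games_def)
    then show ?case ..
  next
    case (Suc n)
    then obtain xs where xs: "xs \<in> games n" ..
    let ?ys = "(Suc n, Blue) # (Suc n, Red) # xs"
    have ins: "{1..Suc n} = insert (Suc n) {1..n}" by auto
    have s: "set xs = {1..n} \<times> {Blue, Red}" and d: "distinct xs"
      and p: "\<And>l. l \<in> {1..n} \<Longrightarrow> precedes xs (l, Blue) (l, Red)"
      using xs by (auto simp: games_def permutations_of_set_def)
    have "set ?ys = {1..Suc n} \<times> {Blue, Red}"
      unfolding ins by (simp add: s)
    moreover have "distinct ?ys"
      using d by (simp add: s)
    moreover have "precedes ?ys (l, Blue) (l, Red)" if l: "l \<in> {1..Suc n}" for l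
    proof (cases "l = Suc n")
      case True
      then show ?thesis unfolding precedes_def by (intro exI[of _ 0] exI[of _ 1]) simp
    next
      case False
      then have "l \<in> {1..n}" using l by auto
      from p[OF this] obtain i j
        where "i < j" "j < length xs" "xs ! i = (l, Blue)" "xs ! j = (l, Red)"
        unfolding precedes_def by blast
      then show ?thesis unfolding precedes_def
        by (intro exI[of _ "Suc (Suc i)"] exI[of _ "Suc (Suc j)"]) simp
    qed
    ultimately have "?ys \<in> games (Suc n)" by (simp add: games_def permutations_of_set_def)
    then show ?case ..
  qed
  then show ?thesis by blast
qed

end

theory Submission
  imports Defs "HOL-Library.Sublist" "HOL-Real_Asymp.Real_Asymp"
begin

text \<open>
  The joint law of the first \<open>k\<close> block lengths can be written down exactly, and the theorem is a local
  limit theorem for it. Reveal the game from left to right. If \<open>a\<close> labels have both cards left and \<open>b\<close>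
  labels only the red one, there are \<open>(2a + b)! / 2\<^sup>a\<close> ways to continue, a next blue card can have \<open>a\<close>
  labels and a next red card \<open>b\<close> labels. Prescribing \<open>D\<^sub>1 = d\<^sub>1, \<dots>, D\<^sub>k = d\<^sub>k\<close> is the same as prescribing
  the colours of the first \<open>r\<^sub>k\<close> cards, where \<open>r\<^sub>j = d\<^sub>1 + \<dots> + d\<^sub>j\<close>
  (\<open>block_lengths_iff_prefix\<close>), and multiplying the numbers of choices gives
  (\<open>num_with_colours_block_pattern\<close>, \<open>pmf_block_lengths\<close>) the probability
  \<open>\<Prod>\<^sub>j (r\<^sub>j - 2j + 1) \<cdot> 2n (2n - 2) (2n - 4) \<dots> / (2n (2n - 1) (2n - 2) \<dots>)\<close>
  with \<open>r\<^sub>k - k\<close> factors in the numerator and \<open>r\<^sub>k\<close> in the denominator of the quotient.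

  For \<open>r\<^sub>k\<close> about \<open>2 s \<surd>n\<close> the quotient is about \<open>(2n)\<^bsup>-k\<^esup> exp (- 2 s\<^sup>2 + s\<^sup>2)\<close>, as in the birthday problem
  (\<open>tendsto_prod_one_minus\<close>), and the product in front is about \<open>(2 \<surd>n)\<^sup>k s\<^sub>1 \<dots> s\<^sub>k\<close>. Hence the
  probabilities, multiplied by the number \<open>(2 \<surd>n)\<^sup>k\<close> of lattice points per unit volume, converge at every
  point to the claimed density (\<open>local_limit_block_lengths\<close>). This density has integral \<open>1\<close>, since
  integrating out the last coordinate gives the density for \<open>k - 1\<close> (\<open>nn_integral_limit_density\<close>).
  Pointwise convergence of densities to a probability density implies convergence in \<open>L\<^sup>1\<close> by
  Scheffe's lemma, and therefore convergence in distribution (\<open>local_limit_imp_weak_convergence\<close>).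
\<close>

section \<open>Counting partially revealed games by their colours\<close>

text \<open>What remains to be dealt when a game is revealed from left to right: for the labels in \<open>A\<close> both cards
are still to come, for the labels in \<open>B\<close> the blue card is already on the table and only the red one
is missing. Revealing a card of a game leads from one such pair of label sets to another, and this
is what all counts below recurse on.\<close>

definition partial_games :: "nat set \<Rightarrow> nat set \<Rightarrow> card list set" where
  "partial_games A B = {xs \<in> permutations_of_set (A \<times> {Blue} \<union> (A \<union> B) \<times> {Red}).
     \<forall>l\<in>A. precedes xs (l, Blue) (l, Red)}"

lemma games_eq_partial_games: "games n = partial_games {1..n} {}"
proof -
  have "{1..n} \<times> {Blue, Red} = {1..n} \<times> {Blue} \<union> ({1..n} \<union> {}) \<times> {Red}" by auto
  then show ?thesis by (simp only: games_def partial_games_def)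
qed

lemma finite_partial_games: "finite A \<Longrightarrow> finite B \<Longrightarrow> finite (partial_games A B)"
  unfolding partial_games_def
  by (rule finite_subset[of _ "permutations_of_set (A \<times> {Blue} \<union> (A \<union> B) \<times> {Red})"]) auto

lemma precedes_Cons: "precedes (x # xs) a b \<longleftrightarrow> (x = a \<and> b \<in> set xs) \<or> precedes xs a b"
proof
  assume "precedes (x # xs) a b"
  then obtain i j where ij: "i < j" "j < Suc (length xs)" "(x # xs) ! i = a" "(x # xs) ! j = b"
    unfolding precedes_def by auto
  then obtain j' where j': "j = Suc j'" by (cases j) auto
  show "(x = a \<and> b \<in> set xs) \<or> precedes xs a b"
  proof (cases i)
    case 0
    then show ?thesis using ij j' by auto
  next
    case (Suc i')
    then show ?thesis using ij j' unfolding precedes_def by auto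
  qed
next
  assume "(x = a \<and> b \<in> set xs) \<or> precedes xs a b"
  then show "precedes (x # xs) a b"
  proof
    assume *: "x = a \<and> b \<in> set xs"
    then obtain j where "j < length xs" "xs ! j = b" by (auto simp: in_set_conv_nth)
    then show ?thesis using * unfolding precedes_def
      by (intro exI[of _ 0] exI[of _ "Suc j"]) auto
  next
    assume "precedes xs a b"
    then obtain i j where "i < j" "j < length xs" "xs ! i = a" "xs ! j = b"
      unfolding precedes_def by auto
    then show ?thesis unfolding precedes_def
      by (intro exI[of _ "Suc i"] exI[of _ "Suc j"]) auto
  qed
qed

lemma precedes_in_set: "precedes xs a b \<Longrightarrow> b \<in> set xs"
  unfolding precedes_def by auto

lemma Cons_in_permutations_of_set:
  "x # xs \<in> permutations_of_set S \<longleftrightarrow> x \<in> S \<and> xs \<in> permutations_of_set (S - {x})"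
  unfolding permutations_of_set_def by auto

lemma Cons_Blue_in_partial_games:
  assumes "A \<inter> B = {}"
  shows "(a, Blue) # xs \<in> partial_games A B \<longleftrightarrow> a \<in> A \<and> xs \<in> partial_games (A - {a}) (insert a B)"
proof (cases "a \<in> A")
  case True
  let ?S = "A \<times> {Blue} \<union> (A \<union> B) \<times> {Red}"
  let ?S' = "(A - {a}) \<times> {Blue} \<union> ((A - {a}) \<union> insert a B) \<times> {Red}"
  have "(a, Blue) \<in> ?S" and S': "?S - {(a, Blue)} = ?S'" using True by auto
  moreover have "(\<forall>l\<in>A. precedes ((a, Blue) # xs) (l, Blue) (l, Red))
      \<longleftrightarrow> (\<forall>l\<in>A - {a}. precedes xs (l, Blue) (l, Red))" if "xs \<in> permutations_of_set ?S'"
  proof -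
    have "(a, Red) \<in> set xs" using that by (simp add: permutations_of_setD)
    then show ?thesis by (auto simp: precedes_Cons)
  qed
  ultimately show ?thesis using True
    unfolding partial_games_def mem_Collect_eq Cons_in_permutations_of_set S' by blast
next
  case False
  then show ?thesis by (auto simp: partial_games_def Cons_in_permutations_of_set)
qed

lemma Cons_Red_in_partial_games:
  assumes "A \<inter> B = {}"
  shows "(b, Red) # xs \<in> partial_games A B \<longleftrightarrow> b \<in> B \<and> xs \<in> partial_games A (B - {b})"
proof (cases "b \<in> B")
  case True
  then have "b \<notin> A" using assms by auto
  let ?S = "A \<times> {Blue} \<union> (A \<union> B) \<times> {Red}"
  let ?S' = "A \<times> {Blue} \<union> (A \<union> (B - {b})) \<times> {Red}"
  have "(b, Red) \<in> ?S" and S': "?S - {(b, Red)} = ?S'" using True \<open>b \<notin> A\<close> by auto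
  moreover have "(\<forall>l\<in>A. precedes ((b, Red) # xs) (l, Blue) (l, Red))
      \<longleftrightarrow> (\<forall>l\<in>A. precedes xs (l, Blue) (l, Red))"
    by (simp add: precedes_Cons)
  ultimately show ?thesis using True
    unfolding partial_games_def mem_Collect_eq Cons_in_permutations_of_set S' by blast
next
  case False
  have "\<not> precedes ((b, Red) # xs) (b, Blue) (b, Red)"
    if "(b, Red) # xs \<in> permutations_of_set S" for S
    using that by (auto simp: precedes_Cons permutations_of_set_def dest: precedes_in_set)
  with False show ?thesis
    unfolding partial_games_def mem_Collect_eq
    by (metis (no_types, lifting) Cons_in_permutations_of_set Un_iff mem_Sigma_iff prod.inject singletonD colour.distinct(1))
qed

lemma card_image_Cons: "card ((#) x ` S) = card S"
  by (rule card_image) simp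

text \<open>A blue first card can be that of any label in \<open>A\<close>, and this label then joins those whose red card is
still missing; the analogous rule for a red first card removes a label from \<open>B\<close>. The property \<open>P\<close>
of the remaining cards is arbitrary, so that the same recursion counts all games and the games with
a given colour pattern.\<close>

lemma card_partial_games_Blue:
  assumes "finite A" "finite B" "A \<inter> B = {}"
  shows "card {xs \<in> partial_games A B. \<exists>y ys. xs = y # ys \<and> snd y = Blue \<and> P ys}
       = (\<Sum>a\<in>A. card {ys \<in> partial_games (A - {a}) (insert a B). P ys})"
proof -
  have "{xs \<in> partial_games A B. \<exists>y ys. xs = y # ys \<and> snd y = Blue \<and> P ys}
      = (\<Union>a\<in>A. (#) (a, Blue) ` {ys \<in> partial_games (A - {a}) (insert a B). P ys})"
  proof (rule set_eqI, goal_cases)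
    case (1 xs)
    show ?case
    proof (cases xs)
      case (Cons y ys)
      obtain l c where y: "y = (l, c)" by (cases y)
      have "xs \<in> {xs \<in> partial_games A B. \<exists>y ys. xs = y # ys \<and> snd y = Blue \<and> P ys}
          \<longleftrightarrow> c = Blue \<and> l \<in> A \<and> ys \<in> partial_games (A - {l}) (insert l B) \<and> P ys"
        unfolding Cons y by (cases c) (simp_all add: Cons_Blue_in_partial_games[OF assms(3)])
      moreover have "xs \<in> (\<Union>a\<in>A. (#) (a, Blue) ` {ys \<in> partial_games (A - {a}) (insert a B). P ys})
          \<longleftrightarrow> c = Blue \<and> l \<in> A \<and> ys \<in> partial_games (A - {l}) (insert l B) \<and> P ys"
        unfolding Cons y image_def by blast
      ultimately show ?thesis by simp
    next
      case Nil
      then show ?thesis by (simp add: image_iff)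
    qed
  qed
  also have "card \<dots> = (\<Sum>a\<in>A. card ((#) (a, Blue) ` {ys \<in> partial_games (A - {a}) (insert a B). P ys}))"
  proof (rule card_UN_disjoint)
    show "\<forall>a\<in>A. finite ((#) (a, Blue) ` {ys \<in> partial_games (A - {a}) (insert a B). P ys})"
      using assms(1,2) by (simp add: finite_partial_games)
  qed (use assms(1,2) in \<open>simp, fastforce\<close>)
  finally show ?thesis by (simp add: card_image_Cons)
qed

lemma card_partial_games_Red:
  assumes "finite A" "finite B" "A \<inter> B = {}"
  shows "card {xs \<in> partial_games A B. \<exists>y ys. xs = y # ys \<and> snd y = Red \<and> P ys}
       = (\<Sum>b\<in>B. card {ys \<in> partial_games A (B - {b}). P ys})"
proof -
  have "{xs \<in> partial_games A B. \<exists>y ys. xs = y # ys \<and> snd y = Red \<and> P ys}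
      = (\<Union>b\<in>B. (#) (b, Red) ` {ys \<in> partial_games A (B - {b}). P ys})"
  proof (rule set_eqI, goal_cases)
    case (1 xs)
    show ?case
    proof (cases xs)
      case (Cons y ys)
      obtain l c where y: "y = (l, c)" by (cases y)
      have "xs \<in> {xs \<in> partial_games A B. \<exists>y ys. xs = y # ys \<and> snd y = Red \<and> P ys}
          \<longleftrightarrow> c = Red \<and> l \<in> B \<and> ys \<in> partial_games A (B - {l}) \<and> P ys"
        unfolding Cons y by (cases c) (simp_all add: Cons_Red_in_partial_games[OF assms(3)])
      moreover have "xs \<in> (\<Union>b\<in>B. (#) (b, Red) ` {ys \<in> partial_games A (B - {b}). P ys})
          \<longleftrightarrow> c = Red \<and> l \<in> B \<and> ys \<in> partial_games A (B - {l}) \<and> P ys"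
        unfolding Cons y image_def by blast
      ultimately show ?thesis by simp
    next
      case Nil
      then show ?thesis by (simp add: image_iff)
    qed
  qed
  also have "card \<dots> = (\<Sum>b\<in>B. card ((#) (b, Red) ` {ys \<in> partial_games A (B - {b}). P ys}))"
  proof (rule card_UN_disjoint)
    show "\<forall>b\<in>B. finite ((#) (b, Red) ` {ys \<in> partial_games A (B - {b}). P ys})"
      using assms(1,2) by (simp add: finite_partial_games)
  qed (use assms(1,2) in \<open>simp, fastforce\<close>)
  finally show ?thesis by (simp add: card_image_Cons)
qed

text \<open>The number of arrangements with \<open>a\<close> complete pairs and \<open>b\<close> single red cards whose colours start
with the given word: the label of a first blue card is one of \<open>a\<close>, that of a first red card one of
\<open>b\<close>. The values are reals because of the quotient in the base case, which counts all arrangements.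
The predecessors of \<open>0\<close> do no harm as they are multiplied by \<open>0\<close>.\<close>

fun num_with_colours :: "nat \<Rightarrow> nat \<Rightarrow> colour list \<Rightarrow> real" where
  "num_with_colours a b [] = fact (2 * a + b) / 2 ^ a"
| "num_with_colours a b (Blue # w) = real a * num_with_colours (a - 1) (b + 1) w"
| "num_with_colours a b (Red # w) = real b * num_with_colours a (b - 1) w"

lemma card_partial_games:
  assumes "finite A" "finite B" "A \<inter> B = {}"
  shows "real (card (partial_games A B)) = fact (2 * card A + card B) / 2 ^ card A"
  using assms
proof (induction "2 * card A + card B" arbitrary: A B rule: less_induct)
  case less
  let ?a = "card A" and ?b = "card B"
  show ?case
  proof (cases "A = {} \<and> B = {}")
    case True
    then have "partial_games A B = {[]}" by (auto simp: partial_games_def)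
    then show ?thesis using True by simp
  next
    case False
    have nonempty: "xs \<noteq> []" if "xs \<in> partial_games A B" for xs
      using that False by (auto simp: partial_games_def permutations_of_set_def)
    have split: "partial_games A B
        = {xs \<in> partial_games A B. \<exists>y ys. xs = y # ys \<and> snd y = Blue \<and> True}
        \<union> {xs \<in> partial_games A B. \<exists>y ys. xs = y # ys \<and> snd y = Red \<and> True}"
      (is "_ = ?X \<union> ?Y")
    proof -
      have "snd y = Blue \<or> snd y = Red" for y :: card by (cases "snd y") auto
      then show ?thesis using nonempty by (auto simp: neq_Nil_conv) metis
    qed
    have "card (partial_games A B) = card ?X + card ?Y"
      by (subst split, rule card_Un_disjoint)
         (use finite_partial_games[OF less.prems(1,2)] in auto)
    also have "\<dots> = (\<Sum>a\<in>A. card (partial_games (A - {a}) (insert a B)))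
                 + (\<Sum>b\<in>B. card (partial_games A (B - {b})))"
      unfolding card_partial_games_Blue[OF less.prems] card_partial_games_Red[OF less.prems] by simp
    finally have card_rec: "real (card (partial_games A B))
        = (\<Sum>a\<in>A. real (card (partial_games (A - {a}) (insert a B))))
        + (\<Sum>b\<in>B. real (card (partial_games A (B - {b}))))" by simp
    have blue: "(\<Sum>a\<in>A. real (card (partial_games (A - {a}) (insert a B))))
        = 2 * real ?a * (fact (2 * ?a + ?b - 1) / 2 ^ ?a)"
    proof -
      have "real (card (partial_games (A - {a}) (insert a B))) = 2 * (fact (2 * ?a + ?b - 1) / 2 ^ ?a)"
        if a: "a \<in> A" for a
      proof -
        have ca: "card (A - {a}) = ?a - 1" "?a > 0"
          using a less.prems(1) by (auto simp: card_gt_0_iff)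
        have cb: "card (insert a B) = Suc ?b"
          using a less.prems by (intro card_insert_disjoint) auto
        have "real (card (partial_games (A - {a}) (insert a B)))
            = fact (2 * card (A - {a}) + card (insert a B)) / 2 ^ card (A - {a})"
          using a less.prems ca cb by (intro less.hyps) auto
        moreover have "2 * (?a - 1) + Suc ?b = 2 * ?a + ?b - 1" using ca by auto
        moreover have "(2::real) ^ ?a = 2 * 2 ^ (?a - 1)"
          using ca by (metis Suc_diff_1 power_Suc)
        ultimately show ?thesis by (simp only: ca(1) cb)
      qed
      then show ?thesis by simp
    qed
    have red: "(\<Sum>b\<in>B. real (card (partial_games A (B - {b}))))
        = real ?b * (fact (2 * ?a + ?b - 1) / 2 ^ ?a)"
    proof -
      have "real (card (partial_games A (B - {b}))) = fact (2 * ?a + ?b - 1) / 2 ^ ?a"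
        if b: "b \<in> B" for b
      proof -
        have cb: "card (B - {b}) = ?b - 1" "?b > 0"
          using b less.prems(2) by (auto simp: card_gt_0_iff)
        have "real (card (partial_games A (B - {b})))
            = fact (2 * ?a + card (B - {b})) / 2 ^ ?a"
          using b less.prems cb by (intro less.hyps) auto
        moreover have "2 * ?a + (?b - 1) = 2 * ?a + ?b - 1" using cb by auto
        ultimately show ?thesis by (simp add: cb)
      qed
      then show ?thesis by simp
    qed
    have pos: "2 * ?a + ?b > 0" using False less.prems by (auto simp: card_gt_0_iff)
    have "real (card (partial_games A B)) = real (2 * ?a + ?b) * fact (2 * ?a + ?b - 1) / 2 ^ ?a"
      unfolding card_rec blue red by (simp add: field_simps)
    also have "real (2 * ?a + ?b) * fact (2 * ?a + ?b - 1) = fact (2 * ?a + ?b)"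
      using pos by (simp add: fact_reduce)
    finally show ?thesis .
  qed
qed

lemma card_partial_games_prefix:
  assumes "finite A" "finite B" "A \<inter> B = {}"
  shows "real (card {xs \<in> partial_games A B. prefix w (map snd xs)})
       = num_with_colours (card A) (card B) w"
  using assms
proof (induction w arbitrary: A B)
  case Nil
  then show ?case by (simp add: card_partial_games)
next
  case (Cons c w)
  have eq: "{xs \<in> partial_games A B. prefix (c # w) (map snd xs)}
      = {xs \<in> partial_games A B. \<exists>y ys. xs = y # ys \<and> snd y = c \<and> prefix w (map snd ys)}"
  proof -
    have "prefix (c # w) (map snd xs) \<longleftrightarrow> (\<exists>y ys. xs = y # ys \<and> snd y = c \<and> prefix w (map snd ys))"
      for xs :: "card list"
      by (cases xs) auto
    then show ?thesis by simp
  qed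
  show ?case
  proof (cases c)
    case Blue
    have "real (card {ys \<in> partial_games (A - {a}) (insert a B). prefix w (map snd ys)})
        = num_with_colours (card A - 1) (card B + 1) w" if "a \<in> A" for a
    proof -
      have "card (A - {a}) = card A - 1" "card (insert a B) = card B + 1"
        using that Cons.prems by (simp, subst card_insert_disjoint) auto
      moreover have "real (card {ys \<in> partial_games (A - {a}) (insert a B). prefix w (map snd ys)})
        = num_with_colours (card (A - {a})) (card (insert a B)) w"
        using Cons.prems that by (intro Cons.IH) auto
      ultimately show ?thesis by simp
    qed
    then show ?thesis
      unfolding eq unfolding Blue card_partial_games_Blue[OF Cons.prems] by simp
  next
    case Red
    have "real (card {ys \<in> partial_games A (B - {b}). prefix w (map snd ys)})
        = num_with_colours (card A) (card B - 1) w" if "b \<in> B" for b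
    proof -
      have "card (B - {b}) = card B - 1"
        using that Cons.prems by auto
      moreover have "real (card {ys \<in> partial_games A (B - {b}). prefix w (map snd ys)})
        = num_with_colours (card A) (card (B - {b})) w"
        using Cons.prems that by (intro Cons.IH) auto
      ultimately show ?thesis by simp
    qed
    then show ?thesis
      unfolding eq unfolding Red card_partial_games_Red[OF Cons.prems] by simp
  qed
qed

definition block_pattern :: "nat list \<Rightarrow> colour list" where
  "block_pattern ds = concat (map (\<lambda>d. replicate (d - 1) Blue @ [Red]) ds)"

lemma block_pattern_simps:
  "block_pattern [] = []"
  "block_pattern (d # ds) = replicate (d - 1) Blue @ Red # block_pattern ds"
  by (simp_all add: block_pattern_def)

lemma num_with_colours_block:
  "num_with_colours a b (replicate j Blue @ Red # w)
     = (\<Prod>i<j. real a - real i) * real (b + j) * num_with_colours (a - j) (b + j - 1) w"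
proof (induction j arbitrary: a b)
  case 0
  then show ?case by simp
next
  case (Suc j)
  have "num_with_colours a b (replicate (Suc j) Blue @ Red # w)
      = real a * ((\<Prod>i<j. real (a - 1) - real i) * real (b + Suc j)
           * num_with_colours (a - Suc j) (b + Suc j - 1) w)"
  proof -
    have "a - 1 - j = a - Suc j" "b + 1 + j = b + Suc j" by auto
    then show ?thesis
      using Suc[of "a - 1" "b + 1"] by (simp only: replicate_Suc append_Cons num_with_colours.simps)
  qed
  moreover have "real a * (\<Prod>i<j. real (a - 1) - real i) = (\<Prod>i<Suc j. real a - real i)"
  proof (cases "a = 0")
    case True
    then show ?thesis by (subst prod.lessThan_Suc_shift) simp
  next
    case False
    then have "real (a - 1) - real i = real a - real (Suc i)" for i by (simp add: of_nat_diff)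
    then show ?thesis by (subst prod.lessThan_Suc_shift) (simp only: o_def of_nat_0 diff_zero)
  qed
  ultimately show ?case by (simp only: mult.assoc[symmetric])
qed

text \<open>Before the last card of the \<open>m\<close>-th block (counted from \<open>0\<close>) the number of red cards whose blue partner is
already on the table is \<open>b\<close>, plus one for every blue card so far, minus one for each of the \<open>m\<close> red cards
so far; this is the \<open>m\<close>-th factor of the second product. The first product chooses the labels of the
blue cards, and the last factor counts the ways to continue. The factors are taken in the reals, where
they may be negative, but only after an earlier factor has vanished (a card without candidate
labels), so that the formula needs no upper bounds on the block lengths.\<close>

lemma num_with_colours_block_pattern:
  assumes "\<forall>d\<in>set ds. 1 \<le> d"
  shows "num_with_colours a b (block_pattern ds)
     = (\<Prod>i<sum_list ds - length ds. real a - real i)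
       * (\<Prod>m<length ds. real b + real (sum_list (take (Suc m) ds)) - 2 * real m - 1)
       * (fact (2 * a + b - sum_list ds) / 2 ^ (a - (sum_list ds - length ds)))"
  using assms
proof (induction ds arbitrary: a b)
  case Nil
  then show ?case by (simp add: block_pattern_simps)
next
  case (Cons d ds)
  let ?J = "sum_list ds - length ds"
  have d: "1 \<le> d" and ds: "\<forall>d\<in>set ds. 1 \<le> d" using Cons.prems by auto
  have len: "length ds \<le> sum_list ds"
    using ds by (induction ds) auto
  define j where "j = d - 1"
  have dj: "d = Suc j" using d by (simp add: j_def)
  have J: "sum_list (d # ds) - length (d # ds) = j + ?J"
    using len by (simp add: dj)
  have "num_with_colours a b (block_pattern (d # ds))
      = (\<Prod>i<j. real a - real i) * real (b + j) * num_with_colours (a - j) (b + j - 1) (block_pattern ds)"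
    by (simp add: block_pattern_simps num_with_colours_block j_def)
  also have "\<dots> = (\<Prod>i<j + ?J. real a - real i)
       * (\<Prod>m<length (d # ds). real b + real (sum_list (take (Suc m) (d # ds))) - 2 * real m - 1)
       * (fact (2 * a + b - sum_list (d # ds)) / 2 ^ (a - (j + ?J)))"
    \<comment> \<open>In the excluded cases some factor on each side is zero; otherwise no subtraction on the
      naturals in the induction hypothesis is truncated.\<close>
  proof (cases "b + j = 0 \<or> a < j")
    case True
    then show ?thesis
    proof (elim disjE)
      assume "b + j = 0"
      then have "b = 0" "j = 0" by auto
      then have "(\<Prod>m<length (d # ds). real b + real (sum_list (take (Suc m) (d # ds))) - 2 * real m - 1) = 0"
        by (intro prod_zero) (auto intro!: bexI[of _ 0] simp: dj)
      then show ?thesis using \<open>b + j = 0\<close> by simp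
    next
      assume aj: "a < j"
      have "(\<Prod>i<j. real a - real i) = 0" "(\<Prod>i<j + ?J. real a - real i) = 0"
        using aj by (intro prod_zero; force)+
      then show ?thesis by (simp only: mult_zero_left)
    qed
  next
    case False
    then have bj: "b + j \<ge> 1" and aj: "j \<le> a" by auto
    have "(\<Prod>i<j + ?J. real a - real i)
        = (\<Prod>i<j. real a - real i) * (\<Prod>i<?J. real (a - j) - real i)"
    proof -
      have "(\<Prod>i<j + ?J. real a - real i)
          = (\<Prod>i<j. real a - real i) * (\<Prod>i=j..<j + ?J. real a - real i)"
        by (metis le_add1 lessThan_atLeast0 prod.atLeastLessThan_concat zero_le)
      also have "(\<Prod>i=j..<j + ?J. real a - real i) = (\<Prod>i<?J. real (a - j) - real i)"
        using aj by (intro prod.reindex_bij_witness[of _ "\<lambda>i. i + j" "\<lambda>i. i - j"]) (auto simp: of_nat_diff)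
      finally show ?thesis .
    qed
    moreover have "(\<Prod>m<length (d # ds). real b + real (sum_list (take (Suc m) (d # ds))) - 2 * real m - 1)
        = real (b + j) * (\<Prod>m<length ds. real (b + j - 1) + real (sum_list (take (Suc m) ds)) - 2 * real m - 1)"
      using bj by (simp add: prod.lessThan_Suc_shift dj of_nat_diff algebra_simps del: prod.lessThan_Suc)
    moreover have "a - j - ?J = a - (j + ?J)" by simp
    moreover have "2 * (a - j) + (b + j - 1) - sum_list ds = 2 * a + b - sum_list (d # ds)"
      using aj bj by (simp add: dj)
    ultimately show ?thesis
      unfolding Cons.IH[OF ds] by (simp only: ac_simps)
  qed
  finally show ?case by (simp only: J)
qed

section \<open>Block lengths and colour patterns\<close>

lemma red_positions_altdef:
  "red_positions xs = map Suc (filter (\<lambda>p. snd (xs ! p) = Red) [0..<length xs])"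
proof -
  have "[1..<Suc (length xs)] = map Suc [0..<length xs]"
    by (simp add: map_Suc_upt del: upt_Suc)
  then show ?thesis by (simp add: red_positions_def filter_map comp_def del: upt_Suc)
qed

lemma red_positions_append:
  "red_positions (xs @ ys) = red_positions xs @ map ((+) (length xs)) (red_positions ys)"
proof -
  have "map ((+) (length xs)) [0..<length ys] = [length xs..<length xs + length ys]"
    by (intro nth_equalityI) auto
  then have upt: "[0..<length (xs @ ys)] = [0..<length xs] @ map ((+) (length xs)) [0..<length ys]"
    using upt_add_eq_append[of 0 "length xs" "length ys"] by simp
  have "filter (\<lambda>p. snd ((xs @ ys) ! p) = Red) [0..<length xs]
      = filter (\<lambda>p. snd (xs ! p) = Red) [0..<length xs]"
    by (intro filter_cong) (auto simp: nth_append)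
  then show ?thesis
    unfolding red_positions_altdef upt by (simp add: filter_map comp_def)
qed


lemma length_red_positions: "length (red_positions xs) = length (filter (\<lambda>y. snd y = Red) xs)"
proof -
  have "filter (\<lambda>y. snd y = Red) xs = filter (\<lambda>y. snd y = Red) (map ((!) xs) [0..<length xs])"
    by (simp only: map_nth)
  then show ?thesis by (simp add: red_positions_altdef filter_map comp_def)
qed

lemma red_positions_bounds:
  assumes "i < length (red_positions xs)"
  shows "i < red_positions xs ! i" "red_positions xs ! i \<le> length xs"
proof -
  have "red_positions xs ! i \<in> set (red_positions xs)" using assms by simp
  then show "red_positions xs ! i \<le> length xs" by (auto simp: red_positions_altdef)
  have sorted: "sorted_wrt (<) (red_positions xs)"
    unfolding red_positions_def by (intro sorted_wrt_filter sorted_wrt_upt)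
  show "i < red_positions xs ! i" using assms
  proof (induction i)
    case 0
    then have "red_positions xs ! 0 \<in> set (red_positions xs)" by simp
    then show ?case by (auto simp: red_positions_altdef)
  next
    case (Suc i)
    then have "red_positions xs ! i < red_positions xs ! Suc i"
      using sorted by (auto simp: sorted_wrt_iff_nth_less)
    then show ?case using Suc by simp
  qed
qed

lemma block_length_eq:
  assumes "i < length (red_positions xs)"
  shows "block_length xs (Suc i) = red_positions xs ! i - (0 # red_positions xs) ! i"
  using red_positions_bounds[OF assms] by (simp add: block_length_def block_def Let_def)

lemma block_length_pos:
  assumes "i < length (red_positions xs)"
  shows "1 \<le> block_length xs (Suc i)"
proof -
  have "(0 # red_positions xs) ! i < red_positions xs ! i"
  proof (cases i)
    case 0
    then show ?thesis using red_positions_bounds[OF assms] by simp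
  next
    case (Suc j)
    have "sorted_wrt (<) (red_positions xs)"
      unfolding red_positions_def by (intro sorted_wrt_filter sorted_wrt_upt)
    then show ?thesis using assms Suc by (auto simp: sorted_wrt_iff_nth_less)
  qed
  then show ?thesis by (simp add: block_length_eq[OF assms])
qed

text \<open>Removing the first block shifts the numbering of the blocks by one and leaves their lengths alone;
this is what allows inductions over the list of block lengths.\<close>

lemma block_length_append:
  assumes "\<forall>x\<in>set bs. snd x = Blue" "snd y = Red"
  shows "block_length (bs @ y # ys) 1 = Suc (length bs)"
    and "i < length (red_positions ys) \<Longrightarrow>
           block_length (bs @ y # ys) (Suc (Suc i)) = block_length ys (Suc i)"
proof -
  have bs: "red_positions bs = []"
    using assms(1) by (auto simp: length_red_positions filter_empty_conv simp flip: length_0_conv)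
  have y: "red_positions [y] = [1]"
    using assms(2) by (simp add: red_positions_def)
  have "red_positions ((bs @ [y]) @ ys)
      = Suc (length bs) # map ((+) (Suc (length bs))) (red_positions ys)"
    by (simp add: red_positions_append bs y del: append_assoc)
  then have r: "red_positions (bs @ y # ys)
      = Suc (length bs) # map ((+) (Suc (length bs))) (red_positions ys)" by simp
  show "block_length (bs @ y # ys) 1 = Suc (length bs)"
    using block_length_eq[of 0 "bs @ y # ys"] by (simp add: r)
  assume i: "i < length (red_positions ys)"
  have "block_length (bs @ y # ys) (Suc (Suc i))
      = red_positions (bs @ y # ys) ! Suc i - red_positions (bs @ y # ys) ! i"
    using block_length_eq[of "Suc i" "bs @ y # ys"] i by (simp add: r)
  also have "\<dots> = block_length ys (Suc i)"
    using i by (cases i) (simp_all add: r block_length_eq)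
  finally show "block_length (bs @ y # ys) (Suc (Suc i)) = block_length ys (Suc i)" .
qed

text \<open>The event that the first block lengths have prescribed values depends only on the colours of an
initial segment of the cards, which turns it into an event counted by \<open>num_with_colours\<close>.\<close>

lemma block_lengths_iff_prefix:
  assumes "length ds \<le> length (red_positions xs)" "\<forall>d\<in>set ds. 1 \<le> d"
  shows "(\<forall>i<length ds. block_length xs (Suc i) = ds ! i)
           \<longleftrightarrow> prefix (block_pattern ds) (map snd xs)"
  using assms
proof (induction ds arbitrary: xs)
  case Nil
  then show ?case by (simp add: block_pattern_simps)
next
  case (Cons d ds)
  then have "filter (\<lambda>y. snd y = Red) xs \<noteq> []"
    by (auto simp: length_red_positions)
  then have "\<exists>x\<in>set xs. snd x = Red"
    by (simp add: filter_empty_conv)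
  then obtain bs y ys where xs: "xs = bs @ y # ys" "snd y = Red" "\<forall>z\<in>set bs. snd z \<noteq> Red"
    using split_list_first_prop[of xs "\<lambda>x. snd x = Red"] by blast
  have bs: "\<forall>z\<in>set bs. snd z = Blue"
    using xs(3) colour.exhaust by blast
  have "filter (\<lambda>z. snd z = Red) bs = []"
    using xs(3) by (simp add: filter_empty_conv)
  then have ys: "length ds \<le> length (red_positions ys)"
    using Cons.prems(1) by (simp add: length_red_positions xs(1,2))
  have "map snd bs = replicate (length bs) Blue"
    using bs by (metis length_map map_replicate_const map_cong)
  then have colours: "map snd xs = replicate (length bs) Blue @ Red # map snd ys"
    by (simp add: xs(1,2))
  have prefix_blocks: "prefix (replicate m Blue @ Red # w) (replicate j Blue @ Red # v)
      \<longleftrightarrow> m = j \<and> prefix w v" for m j w v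
  proof (induction m arbitrary: j)
    case 0
    show ?case by (cases j) auto
  next
    case (Suc m)
    show ?case by (cases j) (auto simp: Suc)
  qed
  have "(\<forall>i<length (d # ds). block_length xs (Suc i) = (d # ds) ! i)
      \<longleftrightarrow> block_length xs 1 = d \<and> (\<forall>i<length ds. block_length xs (Suc (Suc i)) = ds ! i)"
    by (auto simp: less_Suc_eq_0_disj)
  also have "\<dots> \<longleftrightarrow> Suc (length bs) = d \<and> (\<forall>i<length ds. block_length ys (Suc i) = ds ! i)"
    using block_length_append[OF bs xs(2)] ys by (auto simp: xs(1))
  also have "(\<forall>i<length ds. block_length ys (Suc i) = ds ! i) \<longleftrightarrow> prefix (block_pattern ds) (map snd ys)"
    using ys Cons.prems by (intro Cons.IH) auto
  also have "Suc (length bs) = d \<and> prefix (block_pattern ds) (map snd ys)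
      \<longleftrightarrow> prefix (block_pattern (d # ds)) (map snd xs)"
    using Cons.prems(2) by (auto simp: block_pattern_simps colours prefix_blocks)
  finally show ?case .
qed

lemma length_red_positions_game:
  assumes "xs \<in> games n"
  shows "length (red_positions xs) = n"
proof -
  have s: "set xs = {1..n} \<times> {Blue, Red}" and d: "distinct xs"
    using assms by (auto simp: games_def permutations_of_set_def)
  have "length (red_positions xs) = card (set (filter (\<lambda>y. snd y = Red) xs))"
    unfolding length_red_positions using d by (metis distinct_card distinct_filter)
  also have "set (filter (\<lambda>y. snd y = Red) xs) = {1..n} \<times> {Red}"
    using s by auto
  finally show ?thesis by (simp add: card_cartesian_product)
qed

section \<open>The exact joint distribution of the block lengths\<close>

definition block_lengths :: "nat \<Rightarrow> card list \<Rightarrow> nat \<Rightarrow> nat" where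
  "block_lengths k xs = (\<lambda>i\<in>{1..k}. block_length xs i)"

lemma block_lengths_in_PiE:
  assumes "xs \<in> games n" "k \<le> n"
  shows "block_lengths k xs \<in> {1..k} \<rightarrow>\<^sub>E {1..}"
proof -
  have "1 \<le> block_length xs i" if "i \<in> {1..k}" for i
  proof -
    have "i - 1 < length (red_positions xs)" "Suc (i - 1) = i"
      using length_red_positions_game[OF assms(1)] that assms(2) by auto
    then show ?thesis using block_length_pos[of "i - 1" xs] by simp
  qed
  then show ?thesis by (auto simp: block_lengths_def)
qed

lemma set_pmf_block_lengths:
  "set_pmf (map_pmf (block_lengths k) (random_game n)) = block_lengths k ` games n"
  by (simp add: random_game_def set_pmf_of_set finite_games games_nonempty)

lemma set_pmf_block_lengths_subset:
  assumes "k \<le> n"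
  shows "set_pmf (map_pmf (block_lengths k) (random_game n)) \<subseteq> {1..k} \<rightarrow>\<^sub>E {1..}"
  unfolding set_pmf_block_lengths
  by (rule image_subsetI) (rule block_lengths_in_PiE[OF _ assms])

lemma block_lengths_eq_iff_prefix:
  assumes "xs \<in> games n" "k \<le> n" "d \<in> {1..k} \<rightarrow>\<^sub>E {1..}"
  shows "block_lengths k xs = d \<longleftrightarrow> prefix (block_pattern (map d [1..<Suc k])) (map snd xs)"
proof -
  let ?ds = "map d [1..<Suc k]"
  have "block_lengths k xs = d \<longleftrightarrow> (\<forall>i\<in>{1..k}. block_length xs i = d i)"
    using assms(3) by (auto simp: block_lengths_def fun_eq_iff PiE_def extensional_def)
  also have "\<dots> \<longleftrightarrow> (\<forall>i<k. block_length xs (Suc i) = d (Suc i))"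
  proof -
    have "{1..k} = Suc ` {..<k}" by (simp add: image_Suc_lessThan)
    then show ?thesis by (metis (no_types, lifting) image_iff lessThan_iff)
  qed
  also have "\<dots> \<longleftrightarrow> (\<forall>i<length ?ds. block_length xs (Suc i) = ?ds ! i)"
    by (simp del: upt_Suc)
  also have "\<dots> \<longleftrightarrow> prefix (block_pattern ?ds) (map snd xs)"
    using assms by (intro block_lengths_iff_prefix)
      (auto simp: length_red_positions_game PiE_iff simp del: upt_Suc)
  finally show ?thesis .
qed

lemma sum_list_take_map_upt:
  fixes d :: "nat \<Rightarrow> nat"
  assumes "m \<le> k"
  shows "sum_list (take m (map d [1..<Suc k])) = (\<Sum>i=1..m. d i)"
proof -
  have "take m (map d [1..<Suc k]) = map d [1..<Suc m]"
    using assms by (simp add: take_map take_upt del: upt_Suc)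
  then show ?thesis
    by (simp add: interv_sum_list_conv_sum_set_nat atLeastLessThanSuc_atLeastAtMost del: upt_Suc)
qed

lemma prod_diff_eq_power_mult:
  assumes "x \<noteq> 0"
  shows "(\<Prod>i<m. x - real i) = x ^ m * (\<Prod>i<m. 1 - real i / x)"
proof -
  have "(\<Prod>i<m. x - real i) = (\<Prod>i<m. x * (1 - real i / x))"
    using assms by (intro prod.cong) (auto simp: field_simps)
  then show ?thesis by (simp add: prod.distrib)
qed

lemma fact_div_fact_diff:
  assumes "r \<le> N"
  shows "(fact N :: real) = (\<Prod>i<r. real N - real i) * fact (N - r)"
  using assms
proof (induction r)
  case (Suc r)
  have "fact (N - r) = real (N - r) * fact (N - Suc r)"
    using Suc.prems by (subst fact_reduce) (simp_all add: Suc_diff_Suc)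
  then show ?case using Suc by (simp add: of_nat_diff)
qed simp

text \<open>The exact joint distribution, in the form in which the limit can be read off. Let \<open>r\<^sub>j = d\<^sub>1 + \<dots> + d\<^sub>j\<close>
be the position of the \<open>j\<close>-th red card. The first factor has \<open>k\<close> factors of order \<open>\<surd>n\<close> over
\<open>(2n)\<^sup>k\<close> and becomes the polynomial part of the density; the quotient of the two products, which
comes from the quotient of \<open>n (n - 1) \<dots>\<close> and \<open>2n (2n - 1) \<dots>\<close> with \<open>r - k\<close> and \<open>r\<close> factors, becomes the
Gaussian part.\<close>

lemma pmf_block_lengths:
  fixes d :: "nat \<Rightarrow> nat"
  assumes "1 \<le> n" "k \<le> n" and d: "d \<in> {1..k} \<rightarrow>\<^sub>E {1..}" and r: "r = (\<Sum>i=1..k. d i)" "r \<le> n"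
  shows "pmf (map_pmf (block_lengths k) (random_game n)) d
     = (\<Prod>j=1..k. real (\<Sum>i=1..j. d i) - 2 * real j + 1) / (2 * real n) ^ k
       * ((\<Prod>i<r - k. 1 - real i / real n) / (\<Prod>i<r. 1 - real i / (2 * real n)))"
proof -
  let ?ds = "map d [1..<Suc k]"
  define J where "J = r - k"
  define Q where "Q = (\<Prod>j=1..k. real (\<Sum>i=1..j. d i) - 2 * real j + 1)"
  have len: "length ?ds = k" by simp
  have sum: "sum_list ?ds = r"
    using sum_list_take_map_upt[of k k d] by (simp add: r(1) del: upt_Suc)
  have "(\<Sum>i=1..k. 1) \<le> (\<Sum>i=1..k. d i)"
    using d by (intro sum_mono) (auto simp: PiE_iff)
  then have kr: "k \<le> r" by (simp add: r(1))
  have card_games: "real (card (games n)) = fact (2 * n) / 2 ^ n"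
    using card_partial_games[of "{1..n}" "{}"] by (simp add: games_eq_partial_games)
  have "pmf (map_pmf (block_lengths k) (random_game n)) d
      = real (card (games n \<inter> block_lengths k -` {d})) / real (card (games n))"
    by (simp add: pmf_map random_game_def measure_pmf_of_set finite_games games_nonempty)
  also have "games n \<inter> block_lengths k -` {d}
      = {xs \<in> partial_games {1..n} {}. prefix (block_pattern ?ds) (map snd xs)}"
    using block_lengths_eq_iff_prefix[OF _ assms(2) d]
    by (auto simp: games_eq_partial_games simp del: upt_Suc)
  also have "real (card \<dots>) = num_with_colours n 0 (block_pattern ?ds)"
    using card_partial_games_prefix[of "{1..n}" "{}" "block_pattern ?ds"] by (simp del: upt_Suc)
  also have "\<dots> = (\<Prod>i<J. real n - real i)
      * (\<Prod>m<k. real (sum_list (take (Suc m) ?ds)) - 2 * real m - 1)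
      * (fact (2 * n - r) / 2 ^ (n - J))"
  proof -
    have "\<forall>x\<in>set ?ds. 1 \<le> x" using d by (auto simp: PiE_iff simp del: upt_Suc)
    then show ?thesis
      unfolding num_with_colours_block_pattern[OF \<open>\<forall>x\<in>set ?ds. 1 \<le> x\<close>] len sum J_def
      by (simp del: upt_Suc)
  qed
  also have "(\<Prod>m<k. real (sum_list (take (Suc m) ?ds)) - 2 * real m - 1) = Q"
  proof -
    have "(\<Prod>m<k. real (sum_list (take (Suc m) ?ds)) - 2 * real m - 1)
        = (\<Prod>m<k. real (\<Sum>i=1..Suc m. d i) - 2 * real m - 1)"
      by (intro prod.cong refl) (simp only: sum_list_take_map_upt Suc_leI lessThan_iff)
    also have "\<dots> = Q"
      unfolding Q_def
      by (rule prod.reindex_bij_witness[of _ "\<lambda>j. j - 1" Suc]) (auto simp: of_nat_diff)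
    finally show ?thesis .
  qed
  also have "(\<Prod>i<J. real n - real i) * Q * (fact (2 * n - r) / 2 ^ (n - J)) / real (card (games n))
      = Q * ((2 ^ J * (\<Prod>i<J. real n - real i)) / (\<Prod>i<r. real (2 * n) - real i))"
  proof -
    have "(2::real) ^ n = 2 ^ J * 2 ^ (n - J)"
      using r(2) by (simp add: J_def flip: power_add)
    moreover have "(fact (2 * n) :: real) = (\<Prod>i<r. real (2 * n) - real i) * fact (2 * n - r)"
      using r(2) by (intro fact_div_fact_diff) simp
    ultimately show ?thesis unfolding card_games by (simp add: divide_simps)
  qed
  also have "2 ^ J * (\<Prod>i<J. real n - real i) = (2 * real n) ^ J * (\<Prod>i<J. 1 - real i / real n)"
    using assms(1) by (subst prod_diff_eq_power_mult) (auto simp: power_mult_distrib)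
  also have "(\<Prod>i<r. real (2 * n) - real i) = (2 * real n) ^ J * (2 * real n) ^ k * (\<Prod>i<r. 1 - real i / (2 * real n))"
  proof -
    have "(2 * real n) ^ r = (2 * real n) ^ J * (2 * real n) ^ k"
      using kr by (simp only: J_def le_add_diff_inverse2 flip: power_add)
    then show ?thesis
      using prod_diff_eq_power_mult[of "2 * real n" r] assms(1)
      by (simp only: of_nat_mult of_nat_numeral)
  qed
  finally show ?thesis using assms(1) by (simp add: Q_def J_def)
qed

section \<open>Products of numbers close to one\<close>

text \<open>The birthday-problem asymptotics. Since \<open>ln (1 - y) = - y + O(y\<^sup>2)\<close>, the logarithm of the product is
\<open>- m\<^sup>2 / (2N)\<close> up to the errors \<open>m / (2N)\<close> and \<open>O(m\<^sup>3 / N\<^sup>2)\<close>, which vanish when \<open>m\<close> is of order \<open>\<surd>N\<close>.\<close>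

lemma tendsto_prod_one_minus:
  fixes m :: "nat \<Rightarrow> nat" and N :: "nat \<Rightarrow> real"
  assumes N: "filterlim N at_top sequentially"
    and m: "(\<lambda>n. real (m n) / sqrt (N n)) \<longlonglongrightarrow> t"
  shows "(\<lambda>n. \<Prod>i<m n. 1 - real i / N n) \<longlonglongrightarrow> exp (- t\<^sup>2 / 2)"
proof -
  have Npos: "\<forall>\<^sub>F n in sequentially. N n > 0"
    using N by (rule eventually_compose_filterlim[OF eventually_gt_at_top])
  have inv: "(\<lambda>n. 1 / sqrt (N n)) \<longlonglongrightarrow> 0"
    by (intro tendsto_divide_0[OF tendsto_const] filterlim_at_top_imp_at_infinity
          filterlim_compose[OF sqrt_at_top N])
  have m0: "(\<lambda>n. real (m n) / N n) \<longlonglongrightarrow> 0"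
  proof -
    have "(\<lambda>n. real (m n) / sqrt (N n) * (1 / sqrt (N n))) \<longlonglongrightarrow> t * 0"
      by (intro tendsto_mult m inv)
    moreover have "\<forall>\<^sub>F n in sequentially. real (m n) / sqrt (N n) * (1 / sqrt (N n)) = real (m n) / N n"
      using Npos by eventually_elim simp
    ultimately show ?thesis by (auto intro: Lim_transform_eventually)
  qed
  have small: "\<forall>\<^sub>F n in sequentially. real (m n) / N n < 1 / 2"
    using m0 by (rule order_tendstoD) simp
  \<comment> \<open>The product lies between \<open>exp (- S n - E n)\<close> and \<open>exp (- S n)\<close>: here \<open>S n\<close> is the main term of the
    negated logarithm, and \<open>E n = 2 m\<^sup>3 / N\<^sup>2\<close> bounds the sum of the quadratic errors \<open>2 (i / N)\<^sup>2\<close>.\<close>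
  define S where "S n = (\<Sum>i<m n. real i / N n)" for n
  have S_eq: "S n = (real (m n) / sqrt (N n))\<^sup>2 / 2 - real (m n) / N n / 2" if "N n > 0" for n
  proof -
    have "2 * (\<Sum>i<m. real i) = real m * (real m - 1)" for m :: nat
      by (induction m) (auto simp: algebra_simps)
    from this[of "m n"] have "S n = real (m n) * (real (m n) - 1) / 2 / N n"
      unfolding S_def sum_divide_distrib[symmetric] by (metis nonzero_mult_div_cancel_left zero_neq_numeral)
    then show ?thesis using that by (simp add: power_divide field_simps power2_eq_square)
  qed
  have S_lim: "S \<longlonglongrightarrow> t\<^sup>2 / 2"
  proof -
    have "(\<lambda>n. (real (m n) / sqrt (N n))\<^sup>2 / 2 - real (m n) / N n / 2) \<longlonglongrightarrow> t\<^sup>2 / 2 - 0 / 2"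
      by (intro tendsto_intros m m0) simp_all
    moreover have "\<forall>\<^sub>F n in sequentially. (real (m n) / sqrt (N n))\<^sup>2 / 2 - real (m n) / N n / 2 = S n"
      using Npos by eventually_elim (simp add: S_eq)
    ultimately show ?thesis by (auto intro: Lim_transform_eventually)
  qed
  define E where "E n = 2 * (real (m n) / N n) * (real (m n) / sqrt (N n))\<^sup>2" for n
  have E_lim: "E \<longlonglongrightarrow> 0"
  proof -
    have "(\<lambda>n. 2 * (real (m n) / N n) * (real (m n) / sqrt (N n))\<^sup>2) \<longlonglongrightarrow> 2 * 0 * t\<^sup>2"
      by (intro tendsto_intros m m0)
    then show ?thesis by (simp add: E_def[abs_def])
  qed
  have bounds: "exp (- S n - E n) \<le> (\<Prod>i<m n. 1 - real i / N n) \<and>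
                (\<Prod>i<m n. 1 - real i / N n) \<le> exp (- S n)"
    if n: "N n > 0" "real (m n) / N n < 1 / 2" for n
  proof -
    have x: "0 \<le> real i / N n" "real i / N n \<le> real (m n) / N n" if "i < m n" for i
      using that n by (auto intro!: divide_right_mono)
    have lower: "exp (- (real i / N n) - 2 * (real (m n) / N n)\<^sup>2) \<le> 1 - real i / N n"
      if i: "i < m n" for i
    proof -
      have "- (real i / N n) - 2 * (real i / N n)\<^sup>2 \<le> ln (1 - real i / N n)"
        using x[OF i] n by (intro ln_one_minus_pos_lower_bound) linarith+
      moreover have "(real i / N n)\<^sup>2 \<le> (real (m n) / N n)\<^sup>2"
        using x[OF i] by (intro power_mono)
      ultimately have "- (real i / N n) - 2 * (real (m n) / N n)\<^sup>2 \<le> ln (1 - real i / N n)"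
        by linarith
      moreover have "1 - real i / N n > 0" using x[OF i] n by linarith
      ultimately show ?thesis by (metis exp_le_cancel_iff exp_ln)
    qed
    have "exp (- S n - E n) = (\<Prod>i<m n. exp (- (real i / N n) - 2 * (real (m n) / N n)\<^sup>2))"
    proof -
      have "E n = real (m n) * (2 * (real (m n) / N n)\<^sup>2)"
        using n by (simp add: E_def power2_eq_square field_simps)
      then have "- S n - E n = (\<Sum>i<m n. - (real i / N n) - 2 * (real (m n) / N n)\<^sup>2)"
        by (simp add: S_def sum_subtractf sum_negf)
      then show ?thesis by (simp add: exp_sum)
    qed
    also have "\<dots> \<le> (\<Prod>i<m n. 1 - real i / N n)"
      by (intro prod_mono) (use lower in auto)
    finally have 1: "exp (- S n - E n) \<le> (\<Prod>i<m n. 1 - real i / N n)" .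
    have "(\<Prod>i<m n. 1 - real i / N n) \<le> (\<Prod>i<m n. exp (- (real i / N n)))"
    proof (intro prod_mono conjI)
      fix i assume i: "i \<in> {..<m n}"
      show "0 \<le> 1 - real i / N n" using x[of i] i n by auto
      show "1 - real i / N n \<le> exp (- (real i / N n))"
        using exp_ge_add_one_self[of "- (real i / N n)"] by simp
    qed
    also have "\<dots> = exp (- S n)"
      by (simp add: S_def exp_sum flip: sum_negf)
    finally show ?thesis using 1 by blast
  qed
  show ?thesis
  proof (rule tendsto_sandwich)
    show "\<forall>\<^sub>F n in sequentially. exp (- S n - E n) \<le> (\<Prod>i<m n. 1 - real i / N n)"
      using Npos small by eventually_elim (use bounds in blast)
    show "\<forall>\<^sub>F n in sequentially. (\<Prod>i<m n. 1 - real i / N n) \<le> exp (- S n)"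
      using Npos small by eventually_elim (use bounds in blast)
    have "(\<lambda>n. exp (- S n - E n)) \<longlonglongrightarrow> exp (- (t\<^sup>2 / 2) - 0)"
      by (intro tendsto_intros S_lim E_lim)
    then show "(\<lambda>n. exp (- S n - E n)) \<longlonglongrightarrow> exp (- t\<^sup>2 / 2)" by simp
    have "(\<lambda>n. exp (- S n)) \<longlonglongrightarrow> exp (- (t\<^sup>2 / 2))"
      by (intro tendsto_intros S_lim)
    then show "(\<lambda>n. exp (- S n)) \<longlonglongrightarrow> exp (- t\<^sup>2 / 2)" by simp
  qed
qed

section \<open>The limit density is a probability density\<close>

lemma limit_density_measurable [measurable]:
  "limit_density k \<in> borel_measurable (lebesgue_product k)"
  unfolding limit_density_def[abs_def] by measurable

lemma limit_density_nonneg: "0 \<le> limit_density k x"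
  unfolding limit_density_def by (auto intro!: mult_nonneg_nonneg prod_nonneg sum_nonneg)

text \<open>With \<open>s = x\<^sub>1 + \<dots> + x\<^sub>k\<close>, the last coordinate enters only through \<open>2 (s + y) exp (- (s + y)\<^sup>2)\<close>, the
derivative of \<open>- exp (- (s + y)\<^sup>2)\<close>; integrating it over \<open>y \<ge> 0\<close> leaves \<open>exp (- s\<^sup>2)\<close>. So the
densities for different \<open>k\<close> are consistent, and since the one for \<open>k = 0\<close> is the constant \<open>1\<close> on a
one-point space, all of them have integral \<open>1\<close>.\<close>

lemma nn_integral_limit_density_last:
  "(\<integral>\<^sup>+ y. ennreal (limit_density (Suc k) (x(Suc k := y))) \<partial>lborel) = ennreal (limit_density k x)"
proof (cases "\<forall>i\<in>{1..k}. 0 \<le> x i")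
  case False
  then obtain i where i: "i \<in> {1..k}" "\<not> 0 \<le> x i" by blast
  then have "\<not> (\<forall>i\<in>{1..Suc k}. 0 \<le> (x(Suc k := y)) i)" for y
    by (intro notI) (drule bspec[of _ _ i]; simp)
  then have "limit_density (Suc k) (x(Suc k := y)) = 0" for y
    unfolding limit_density_def by (simp only: if_False)
  moreover have "limit_density k x = 0"
    unfolding limit_density_def using False by (simp only: if_False)
  ultimately show ?thesis by simp
next
  case True
  define s where "s = (\<Sum>i=1..k. x i)"
  define c where "c = 2 ^ k * (\<Prod>j=1..k. \<Sum>i=1..j. x i)"
  have s: "0 \<le> s" using True by (auto simp: s_def intro!: sum_nonneg)
  have c: "0 \<le> c" using True by (auto simp: c_def intro!: mult_nonneg_nonneg prod_nonneg sum_nonneg)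
  have sums: "(\<Sum>i=1..j. (x(Suc k := y)) i) = (\<Sum>i=1..j. x i)" if "j \<le> k" for j y
    using that by (intro sum.cong) auto
  have dens: "limit_density (Suc k) (x(Suc k := y)) = c * (2 * (s + y) * exp (- (s + y)\<^sup>2)) * indicator {0..} y" for y
  proof (cases "0 \<le> y")
    case y: True
    have "(\<Prod>j=1..k. \<Sum>i=1..j. (x(Suc k := y)) i) = (\<Prod>j=1..k. \<Sum>i=1..j. x i)"
      using sums by (intro prod.cong) auto
    moreover have "\<forall>i\<in>{1..Suc k}. 0 \<le> (x(Suc k := y)) i" using True y by auto
    moreover have "(\<Sum>i=1..Suc k. (x(Suc k := y)) i) = s + y"
      using sums[of k y] by (simp add: s_def)
    ultimately show ?thesis
      using y by (simp add: limit_density_def c_def del: sum.cl_ivl_Suc)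
  next
    case y: False
    then have "\<not> (\<forall>i\<in>{1..Suc k}. 0 \<le> (x(Suc k := y)) i)"
      by (intro notI) (drule bspec[of _ _ "Suc k"]; simp)
    then show ?thesis
      unfolding limit_density_def using y by (simp only: if_False) simp
  qed
  have "(\<integral>\<^sup>+ y. ennreal (limit_density (Suc k) (x(Suc k := y))) \<partial>lborel)
      = (\<integral>\<^sup>+ y. ennreal c * (ennreal (2 * (s + y) * exp (- (s + y)\<^sup>2)) * indicator {0..} y) \<partial>lborel)"
    using s c by (intro nn_integral_cong) (auto simp: dens ennreal_mult' split: split_indicator)
  also have "\<dots> = ennreal c * (\<integral>\<^sup>+ y. ennreal (2 * (s + y) * exp (- (s + y)\<^sup>2)) * indicator {0..} y \<partial>lborel)"
    by (intro nn_integral_cmult) measurable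
  also have "(\<integral>\<^sup>+ y. ennreal (2 * (s + y) * exp (- (s + y)\<^sup>2)) * indicator {0..} y \<partial>lborel)
      = ennreal (0 - (- exp (- (s + 0)\<^sup>2)))"
  proof (rule nn_integral_FTC_atLeast)
    fix y :: real assume y: "0 \<le> y"
    show "DERIV (\<lambda>y. - exp (- (s + y)\<^sup>2)) y :> 2 * (s + y) * exp (- (s + y)\<^sup>2)"
      by (auto intro!: derivative_eq_intros simp: algebra_simps)
    show "0 \<le> 2 * (s + y) * exp (- (s + y)\<^sup>2)" using y s by simp
  next
    show "((\<lambda>y. - exp (- (s + y)\<^sup>2)) \<longlongrightarrow> 0) at_top" by real_asymp
  qed measurable
  also have "ennreal c * \<dots> = ennreal (limit_density k x)"
    using True c by (simp add: limit_density_def c_def s_def ennreal_mult')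
  finally show ?thesis .
qed

lemma nn_integral_limit_density: "(\<integral>\<^sup>+ x. ennreal (limit_density k x) \<partial>lebesgue_product k) = 1"
proof (induction k)
  case 0
  show ?case by (simp add: limit_density_def PiM_empty nn_integral_count_space_finite)
next
  case (Suc k)
  interpret product_sigma_finite "\<lambda>_::nat. lborel :: real measure" by standard
  have ins: "{1..Suc k} = insert (Suc k) {1..k}" by auto
  have "(\<integral>\<^sup>+ x. ennreal (limit_density (Suc k) x) \<partial>lebesgue_product (Suc k))
      = (\<integral>\<^sup>+ x. \<integral>\<^sup>+ y. ennreal (limit_density (Suc k) (x(Suc k := y))) \<partial>lborel \<partial>lebesgue_product k)"
    using limit_density_measurable[of "Suc k"]
    unfolding ins by (intro product_nn_integral_insert) auto
  also have "\<dots> = (\<integral>\<^sup>+ x. ennreal (limit_density k x) \<partial>lebesgue_product k)"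
    by (intro nn_integral_cong nn_integral_limit_density_last)
  also note Suc
  finally show ?case .
qed

lemma prob_space_limit_density:
  "prob_space (density (lebesgue_product k) (\<lambda>x. ennreal (limit_density k x)))"
proof (rule prob_spaceI)
  show "emeasure (density (lebesgue_product k) (\<lambda>x. ennreal (limit_density k x)))
      (space (density (lebesgue_product k) (\<lambda>x. ennreal (limit_density k x)))) = 1"
    using nn_integral_limit_density[of k]
    by (simp add: emeasure_density del: One_nat_def cong: nn_integral_cong)
qed

section \<open>Local limit theorems and convergence in distribution\<close>

text \<open>The topology and the \<open>\<sigma>\<close>-algebra live on extensional functions on \<open>I\<close>, where continuity is not a
statement about a topological type. The proof moves to the type of all functions by composing with
restriction to \<open>I\<close> in one direction and extension by \<open>0\<close> in the other.\<close>

lemma borel_measurable_powertop_real: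
  fixes g :: "('i :: countable \<Rightarrow> real) \<Rightarrow> real"
  assumes g: "continuous_map (powertop_real I) euclideanreal g"
  shows "g \<in> borel_measurable (PiM I (\<lambda>_. lborel))"
proof -
  define h where "h x = g (restrict x I)" for x
  define e where "e x = (\<lambda>i. if i \<in> I then x i else 0)" for x :: "'i \<Rightarrow> real"
  have "continuous_map (powertop_real UNIV) (powertop_real I) (\<lambda>x. restrict x I)"
    by (auto simp: continuous_map_componentwise intro: continuous_map_product_projection)
  then have "continuous_map (powertop_real UNIV) euclideanreal (g \<circ> (\<lambda>x. restrict x I))"
    using g by (rule continuous_map_compose)
  then have "continuous_on UNIV h"
    by (simp add: h_def[abs_def] comp_def euclidean_product_topology)
  then have h: "h \<in> borel_measurable borel" by (rule borel_measurable_continuous_onI)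
  have "e \<in> measurable (PiM I (\<lambda>_. lborel)) (PiM UNIV (\<lambda>_. borel))"
    unfolding e_def
  proof (rule measurable_PiM_single')
    fix i
    show "(\<lambda>x. if i \<in> I then x i else 0) \<in> measurable (PiM I (\<lambda>_. lborel :: real measure)) borel"
      using measurable_component_singleton[of i I "\<lambda>_. lborel :: real measure"]
      by (cases "i \<in> I") auto
  qed (simp add: space_PiM)
  then have "e \<in> measurable (PiM I (\<lambda>_. lborel)) borel"
    using sets_PiM_equal_borel measurable_cong_sets by blast
  then have "(\<lambda>x. h (e x)) \<in> borel_measurable (PiM I (\<lambda>_. lborel))"
    using h by (rule measurable_compose)
  moreover have "h (e x) = g x" if "x \<in> space (PiM I (\<lambda>_. lborel :: real measure))" for x
  proof -
    have "restrict (e x) I = x"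
      using that by (auto simp: e_def space_PiM PiE_iff extensional_def fun_eq_iff)
    then show ?thesis by (simp add: h_def)
  qed
  ultimately show ?thesis by (simp cong: measurable_cong)
qed

text \<open>The upper corner, in units of \<open>1 / c\<close>, of the lattice cube of side length \<open>1 / c\<close> that contains \<open>x\<close>.
Cubes contain their lower faces, so that the cubes of the lattice points in \<open>{1..}\<close> cover the closed
orthant and convergence of densities can be asked for at every point of it. Negative coordinates are
sent to \<open>0\<close>, which is outside \<open>{1..}\<close>.\<close>

definition cell :: "'i set \<Rightarrow> real \<Rightarrow> ('i \<Rightarrow> real) \<Rightarrow> 'i \<Rightarrow> nat" where
  "cell I c x = (\<lambda>i\<in>I. nat (\<lfloor>c * x i\<rfloor> + 1))"

lemma cell_eq_iff:
  assumes "c > 0" "d \<in> I \<rightarrow>\<^sub>E {1..}" "x \<in> extensional I"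
  shows "cell I c x = d \<longleftrightarrow> x \<in> (\<Pi>\<^sub>E i\<in>I. {(real (d i) - 1) / c..<real (d i) / c})"
proof -
  have *: "nat (\<lfloor>c * y\<rfloor> + 1) = m \<longleftrightarrow> y \<in> {(real m - 1) / c..<real m / c}" if "1 \<le> m" for m y
  proof -
    have "nat (\<lfloor>c * y\<rfloor> + 1) = m \<longleftrightarrow> \<lfloor>c * y\<rfloor> = int m - 1"
      using that by auto
    also have "\<dots> \<longleftrightarrow> real m - 1 \<le> c * y \<and> c * y < real m"
      by (simp add: floor_eq_iff)
    also have "\<dots> \<longleftrightarrow> y \<in> {(real m - 1) / c..<real m / c}"
      using assms(1) by (simp add: field_simps)
    finally show ?thesis .
  qed
  have "cell I c x = d \<longleftrightarrow> (\<forall>i\<in>I. nat (\<lfloor>c * x i\<rfloor> + 1) = d i)"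
    using assms(2) by (auto simp: cell_def fun_eq_iff PiE_iff extensional_def)
  also have "\<dots> \<longleftrightarrow> (\<forall>i\<in>I. x i \<in> {(real (d i) - 1) / c..<real (d i) / c})"
    using assms(2) by (intro ball_cong refl *) (auto simp: PiE_iff)
  finally show ?thesis using assms(3) by (simp add: PiE_iff)
qed

text \<open>Spreading the mass of each lattice point evenly over its cube, which has volume \<open>c\<^bsup>- |I|\<^esup>\<close>, gives a
law with density \<open>c\<^bsup>|I|\<^esup> p (cell x)\<close> on \<open>\<real>\<^sup>I\<close> that agrees with \<open>p\<close> on functions of the cell.\<close>

lemma has_bochner_integral_cell:
  fixes h :: "('i \<Rightarrow> nat) \<Rightarrow> real" and p :: "('i \<Rightarrow> nat) pmf"
  assumes I: "finite I" and c: "c > 0"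
    and p: "finite (set_pmf p)" "set_pmf p \<subseteq> I \<rightarrow>\<^sub>E {1..}"
  shows "has_bochner_integral (PiM I (\<lambda>_. lborel))
           (\<lambda>x. c ^ card I * pmf p (cell I c x) * h (cell I c x)) (\<integral>d. h d \<partial>p)"
proof -
  interpret product_sigma_finite "\<lambda>_::'i. lborel :: real measure" by standard
  let ?L = "PiM I (\<lambda>_. lborel :: real measure)"
  define box where "box d = (\<Pi>\<^sub>E i\<in>I. {(real (d i) - 1) / c..<real (d i) / c})" for d :: "'i \<Rightarrow> nat"
  have box: "box d \<in> sets ?L" "emeasure ?L (box d) = ennreal ((1 / c) ^ card I)" for d
  proof -
    show "box d \<in> sets ?L" unfolding box_def using I by (intro sets_PiM_I_finite) auto
    have "emeasure ?L (box d) = (\<Prod>i\<in>I. ennreal (1 / c))"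
      unfolding box_def using I c
      by (subst emeasure_PiM) (auto simp: divide_right_mono diff_divide_distrib)
    also have "\<dots> = ennreal ((1 / c) ^ card I)"
      using c by (subst prod_ennreal) auto
    finally show "emeasure ?L (box d) = ennreal ((1 / c) ^ card I)" .
  qed
  have "has_bochner_integral ?L (\<lambda>x. indicator (box d) x * (c ^ card I * pmf p d * h d))
      ((1 / c) ^ card I * (c ^ card I * pmf p d * h d))" for d
  proof -
    have "has_bochner_integral ?L (indicator (box d)) (measure ?L (box d))"
      using box[of d] by (intro has_bochner_integral_real_indicator) auto
    moreover have "measure ?L (box d) = (1 / c) ^ card I"
      using c by (simp add: measure_def box(2))
    ultimately show ?thesis by (intro has_bochner_integral_mult_left) simp
  qed
  then have "has_bochner_integral ?L
      (\<lambda>x. \<Sum>d\<in>set_pmf p. indicator (box d) x * (c ^ card I * pmf p d * h d))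
      (\<Sum>d\<in>set_pmf p. (1 / c) ^ card I * (c ^ card I * pmf p d * h d))"
    by (intro has_bochner_integral_sum)
  also have "(\<Sum>d\<in>set_pmf p. (1 / c) ^ card I * (c ^ card I * pmf p d * h d)) = (\<integral>d. h d \<partial>p)"
    using c p(1) by (subst integral_measure_pmf_real[of "set_pmf p"])
      (auto intro!: sum.cong simp: power_divide)
  finally have "has_bochner_integral ?L
      (\<lambda>x. \<Sum>d\<in>set_pmf p. indicator (box d) x * (c ^ card I * pmf p d * h d)) (\<integral>d. h d \<partial>p)" .
  moreover have "(\<Sum>d\<in>set_pmf p. indicator (box d) x * (c ^ card I * pmf p d * h d))
      = c ^ card I * pmf p (cell I c x) * h (cell I c x)" if x: "x \<in> space ?L" for x
  proof -
    have "indicator (box d) x * (c ^ card I * pmf p d * h d)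
        = (if d = cell I c x then c ^ card I * pmf p (cell I c x) * h (cell I c x) else 0)"
      if "d \<in> set_pmf p" for d
      using cell_eq_iff[of c d I x] that p(2) c x
      by (auto simp: box_def space_PiM PiE_iff indicator_def)
    then have "(\<Sum>d\<in>set_pmf p. indicator (box d) x * (c ^ card I * pmf p d * h d))
        = (\<Sum>d\<in>set_pmf p. if d = cell I c x then c ^ card I * pmf p (cell I c x) * h (cell I c x) else 0)"
      by (intro sum.cong refl)
    also have "\<dots> = c ^ card I * pmf p (cell I c x) * h (cell I c x)"
      using p(1) by (simp add: pmf_eq_0_set_pmf)
    finally show ?thesis .
  qed
  ultimately show ?thesis
    using has_bochner_integral_cong[OF refl _ refl, of ?L
      "\<lambda>x. \<Sum>d\<in>set_pmf p. indicator (box d) x * (c ^ card I * pmf p d * h d)"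
      "\<lambda>x. c ^ card I * pmf p (cell I c x) * h (cell I c x)"] by blast
qed

lemma measurable_scaled_cell [measurable]:
  "(\<lambda>x. \<lambda>i\<in>I. real (cell I c x i) / c) \<in> measurable (PiM I (\<lambda>_. lborel)) (PiM I (\<lambda>_. lborel))"
proof (rule measurable_restrict)
  fix i assume i: "i \<in> I"
  then have "(\<lambda>x. real (nat (\<lfloor>c * x i\<rfloor> + 1)) / c) \<in> borel_measurable (PiM I (\<lambda>_. lborel))"
    by measurable
  then show "(\<lambda>x. real (cell I c x i) / c) \<in> measurable (PiM I (\<lambda>_. lborel)) lborel"
    using i by (simp add: cell_def)
qed

lemma tendsto_scaled_floor:
  fixes c :: "nat \<Rightarrow> real"
  assumes c: "filterlim c at_top sequentially" and "0 \<le> x"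
  shows "(\<lambda>n. real (nat (\<lfloor>c n * x\<rfloor> + 1)) / c n) \<longlonglongrightarrow> x"
proof (rule tendsto_sandwich)
  have pos: "\<forall>\<^sub>F n in sequentially. c n > 0"
    using c by (rule eventually_compose_filterlim[OF eventually_gt_at_top])
  have nat: "real (nat (\<lfloor>c n * x\<rfloor> + 1)) = real_of_int \<lfloor>c n * x\<rfloor> + 1" if "c n > 0" for n
    using that assms(2) by simp
  show "\<forall>\<^sub>F n in sequentially. x \<le> real (nat (\<lfloor>c n * x\<rfloor> + 1)) / c n"
    using pos
  proof eventually_elim
    case (elim n)
    then show ?case
      unfolding nat[OF elim] pos_le_divide_eq[OF elim] by (simp add: mult.commute)
  qed
  show "\<forall>\<^sub>F n in sequentially. real (nat (\<lfloor>c n * x\<rfloor> + 1)) / c n \<le> x + 1 / c n"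
    using pos
  proof eventually_elim
    case (elim n)
    have "real_of_int \<lfloor>c n * x\<rfloor> + 1 \<le> c n * x + 1" by simp
    then have "(real_of_int \<lfloor>c n * x\<rfloor> + 1) / c n \<le> (c n * x + 1) / c n"
      using elim by (intro divide_right_mono) auto
    then show ?case
      unfolding nat[OF elim] using elim by (simp add: add_divide_distrib)
  qed
  have "(\<lambda>n. 1 / c n) \<longlonglongrightarrow> 0"
    by (intro tendsto_divide_0[OF tendsto_const] filterlim_at_top_imp_at_infinity c)
  from tendsto_add[OF tendsto_const this] show "(\<lambda>n. x + 1 / c n) \<longlonglongrightarrow> x" by simp
qed simp

text \<open>A local limit theorem implies convergence in distribution. By Scheffe's lemma the pointwise convergence
of the smoothed densities \<open>F n\<close> to a probability density \<open>f\<close> is convergence in \<open>L\<^sup>1\<close>, so no separate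
tightness argument is needed. The step functions \<open>G n\<close>, which evaluate the test function at the lattice
point instead of at \<open>x\<close> itself, are bounded and converge to \<open>g\<close> on the orthant outside which \<open>f\<close> vanishes. The
expectation is \<open>\<integral> F n * G n\<close>, and it is split as \<open>\<integral> G n * (F n - f) + \<integral> G n * f\<close>.\<close>

lemma local_limit_imp_weak_convergence:
  fixes p :: "nat \<Rightarrow> ('i :: countable \<Rightarrow> nat) pmf" and c :: "nat \<Rightarrow> real"
    and f g :: "('i \<Rightarrow> real) \<Rightarrow> real"
  assumes I: "finite I"
    and c: "\<And>n. c n > 0" "filterlim c at_top sequentially"
    and p: "\<And>n. finite (set_pmf (p n))" "\<And>n. set_pmf (p n) \<subseteq> I \<rightarrow>\<^sub>E {1..}"
    and f: "f \<in> borel_measurable (PiM I (\<lambda>_. lborel))" "\<And>x. 0 \<le> f x"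
      "(\<integral>\<^sup>+ x. ennreal (f x) \<partial>PiM I (\<lambda>_. lborel)) = 1"
      "\<And>x i. i \<in> I \<Longrightarrow> x i < 0 \<Longrightarrow> f x = 0"
    and lim: "\<And>x. x \<in> extensional I \<Longrightarrow>
      (\<lambda>n. c n ^ card I * pmf (p n) (cell I (c n) x)) \<longlonglongrightarrow> f x"
    and g: "continuous_map (powertop_real I) euclideanreal g"
      "bounded (g ` topspace (powertop_real I))"
  shows "(\<lambda>n. \<integral>d. g (\<lambda>i\<in>I. real (d i) / c n) \<partial>p n) \<longlonglongrightarrow> (\<integral>x. f x * g x \<partial>PiM I (\<lambda>_. lborel))"
proof -
  let ?L = "PiM I (\<lambda>_. lborel :: real measure)"
  note f(1)[measurable]
  have top: "topspace (powertop_real I) = extensional I"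
    by (simp add: PiE_def)
  have space: "space ?L = extensional I"
    by (simp add: space_PiM PiE_def)
  have g_meas[measurable]: "g \<in> borel_measurable ?L"
    using g(1) by (rule borel_measurable_powertop_real)
  obtain B where B: "\<And>x. x \<in> extensional I \<Longrightarrow> \<bar>g x\<bar> \<le> B"
    using g(2) unfolding top bounded_iff by auto
  have B0: "0 \<le> B" using B[of "\<lambda>_. undefined"] abs_ge_zero order_trans by (auto simp: extensional_def)
  define F where "F n x = c n ^ card I * pmf (p n) (cell I (c n) x)" for n x
  define G where "G n x = g (\<lambda>i\<in>I. real (cell I (c n) x i) / c n)" for n x
  have G_meas[measurable]: "G n \<in> borel_measurable ?L" for n
    unfolding G_def by measurable
  have G_bound: "\<bar>G n x\<bar> \<le> B" for n x
    unfolding G_def by (intro B) auto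
  have F_integral: "has_bochner_integral ?L (F n) 1" for n
    using has_bochner_integral_cell[OF I c(1) p(1,2), where h = "\<lambda>_. 1"] by (simp add: F_def[abs_def])
  have FG_integral: "has_bochner_integral ?L (\<lambda>x. F n x * G n x) (\<integral>d. g (\<lambda>i\<in>I. real (d i) / c n) \<partial>p n)" for n
    using has_bochner_integral_cell[OF I c(1) p(1,2), where h = "\<lambda>d. g (\<lambda>i\<in>I. real (d i) / c n)"]
    by (simp add: F_def[abs_def] G_def[abs_def])
  have F_int: "integrable ?L (F n)" for n
    using F_integral by (auto simp: has_bochner_integral_iff)
  have F_nonneg: "0 \<le> F n x" for n x
    using c(1)[of n] by (simp add: F_def)
  have f_int: "integrable ?L f"
    using f by (intro integrableI_nonneg) auto
  have Ff_int: "integrable ?L (\<lambda>x. F n x - f x)" for n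
    by (intro Bochner_Integration.integrable_diff F_int f_int)
  have scheffe: "(\<lambda>n. \<integral>\<^sup>+ x. norm (F n x - f x) \<partial>?L) \<longlonglongrightarrow> 0"
  proof (rule Scheffe_lemma2)
    show "AE x in ?L. (\<lambda>n. F n x) \<longlonglongrightarrow> f x"
      using lim by (intro AE_I2) (simp add: space F_def)
    have "(\<integral>\<^sup>+ x. norm (F n x) \<partial>?L) = ennreal 1" for n
      using nn_integral_eq_integral[OF F_int] F_nonneg F_integral[of n]
      by (simp add: has_bochner_integral_iff)
    then show "(\<integral>\<^sup>+ x. norm (F n x) \<partial>?L) \<le> (\<integral>\<^sup>+ x. norm (f x) \<partial>?L)" for n
      using f(2,3) by simp
  qed (use F_int f_int in auto)
  have L1: "(\<lambda>n. \<integral>x. \<bar>F n x - f x\<bar> \<partial>?L) \<longlonglongrightarrow> 0"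
  proof -
    have "(\<integral>\<^sup>+ x. norm (F n x - f x) \<partial>?L) = ennreal (\<integral>x. \<bar>F n x - f x\<bar> \<partial>?L)" for n
      using nn_integral_eq_integral[OF integrable_abs[OF Ff_int[of n]]] by simp
    then show ?thesis using scheffe by (simp add: tendsto_ennreal_iff flip: ennreal_0)
  qed
  have Gf_int: "integrable ?L (\<lambda>x. G n x * f x)" for n
    by (rule Bochner_Integration.integrable_bound[of _ "\<lambda>x. B * f x"])
       (use f_int f(2) G_bound B0 in \<open>auto simp: abs_mult intro!: mult_right_mono\<close>)
  have part1: "(\<lambda>n. \<integral>x. G n x * (F n x - f x) \<partial>?L) \<longlonglongrightarrow> 0"
  proof (rule Lim_null_comparison)
    show "(\<lambda>n. B * (\<integral>x. \<bar>F n x - f x\<bar> \<partial>?L)) \<longlonglongrightarrow> 0"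
      using tendsto_mult_left[OF L1, of B] by simp
    have "norm (\<integral>x. G n x * (F n x - f x) \<partial>?L) \<le> B * (\<integral>x. \<bar>F n x - f x\<bar> \<partial>?L)" for n
    proof -
      have "norm (\<integral>x. G n x * (F n x - f x) \<partial>?L) \<le> (\<integral>x. norm (G n x * (F n x - f x)) \<partial>?L)"
        by (rule integral_norm_bound)
      also have "\<dots> \<le> (\<integral>x. B * \<bar>F n x - f x\<bar> \<partial>?L)"
      proof (rule integral_mono_AE')
        show "integrable ?L (\<lambda>x. B * \<bar>F n x - f x\<bar>)"
          using Ff_int by (intro integrable_mult_right integrable_abs)
      qed (use G_bound B0 in \<open>auto simp: abs_mult intro!: mult_right_mono\<close>)
      finally show ?thesis by simp
    qed
    then show "\<forall>\<^sub>F n in sequentially. norm (\<integral>x. G n x * (F n x - f x) \<partial>?L) \<le> B * (\<integral>x. \<bar>F n x - f x\<bar> \<partial>?L)"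
      by (intro always_eventually allI)
  qed
  have part2: "(\<lambda>n. \<integral>x. G n x * f x \<partial>?L) \<longlonglongrightarrow> (\<integral>x. f x * g x \<partial>?L)"
  proof (rule integral_dominated_convergence)
    show "integrable ?L (\<lambda>x. B * f x)" using f_int by simp
    show "AE x in ?L. norm (G n x * f x) \<le> B * f x" for n
      using G_bound f(2) by (auto simp: abs_mult intro!: mult_right_mono)
    show "AE x in ?L. (\<lambda>n. G n x * f x) \<longlonglongrightarrow> f x * g x"
    proof (rule AE_I2)
      fix x assume "x \<in> space ?L"
      then have x: "x \<in> extensional I" by (simp add: space)
      show "(\<lambda>n. G n x * f x) \<longlonglongrightarrow> f x * g x"
      proof (cases "\<exists>i\<in>I. x i < 0")
        case True
        then have "f x = 0" using f(4) by blast
        then show ?thesis by simp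
      next
        case False
        then have x0: "0 \<le> x i" if "i \<in> I" for i using that by force
        have "limitin (powertop_real I) (\<lambda>n. \<lambda>i\<in>I. real (cell I (c n) x i) / c n) x sequentially"
          using x tendsto_scaled_floor[OF c(2) x0]
          by (auto simp: limitin_componentwise cell_def)
        from continuous_map_limit[OF g(1) this] have "(\<lambda>n. G n x) \<longlonglongrightarrow> g x"
          by (simp add: G_def[abs_def] comp_def)
        then have "(\<lambda>n. G n x * f x) \<longlonglongrightarrow> g x * f x"
          by (intro tendsto_intros)
        then show ?thesis by (simp add: mult.commute)
      qed
    qed
  qed measurable
  have "(\<integral>d. g (\<lambda>i\<in>I. real (d i) / c n) \<partial>p n)
      = (\<integral>x. G n x * (F n x - f x) \<partial>?L) + (\<integral>x. G n x * f x \<partial>?L)" for n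
  proof -
    have FG: "integrable ?L (\<lambda>x. F n x * G n x)"
      "(\<integral>x. F n x * G n x \<partial>?L) = (\<integral>d. g (\<lambda>i\<in>I. real (d i) / c n) \<partial>p n)"
      using FG_integral[of n] by (auto simp: has_bochner_integral_iff)
    have "(\<integral>x. G n x * (F n x - f x) \<partial>?L) = (\<integral>x. F n x * G n x - G n x * f x \<partial>?L)"
      by (simp add: algebra_simps)
    also have "\<dots> = (\<integral>x. F n x * G n x \<partial>?L) - (\<integral>x. G n x * f x \<partial>?L)"
      by (intro Bochner_Integration.integral_diff FG(1) Gf_int)
    finally show ?thesis by (simp add: FG(2))
  qed
  then show ?thesis using tendsto_add[OF part1 part2] by simp
qed

section \<open>The local limit theorem for the block lengths\<close>

text \<open>Put \<open>c = 2 \<surd>n\<close>, so that \<open>2n = c\<^sup>2 / 2\<close>, and let \<open>r\<^sub>j\<close> be the sum of the first \<open>j\<close> block lengths, so that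
\<open>r\<^sub>j / c\<close> tends to \<open>s\<^sub>j = x\<^sub>1 + \<dots> + x\<^sub>j\<close>. Then \<open>c\<^sup>k\<close> times the first factor of \<open>pmf_block_lengths\<close> is
\<open>2\<^sup>k\<close> times the product of the \<open>(r\<^sub>j - 2j + 1) / c\<close>. The two products of the second factor tend to
\<open>exp (- 2 s\<^sub>k\<^sup>2)\<close> and \<open>exp (- s\<^sub>k\<^sup>2)\<close>, whose quotient is the Gaussian factor of the density.\<close>

lemma local_limit_block_lengths:
  assumes k: "k \<ge> 1" and x: "x \<in> extensional {1..k}"
  shows "(\<lambda>n. (2 * sqrt (real n)) ^ k *
            pmf (map_pmf (block_lengths k) (random_game n)) (cell {1..k} (2 * sqrt (real n)) x))
          \<longlonglongrightarrow> limit_density k x"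
proof -
  define c where "c n = 2 * sqrt (real n)" for n
  define P where "P n = pmf (map_pmf (block_lengths k) (random_game n)) (cell {1..k} (c n) x)" for n
  have c_top: "filterlim c at_top sequentially"
    unfolding c_def[abs_def] by real_asymp
  have c_pos: "c n > 0" if "n \<ge> 1" for n
    using that by (simp add: c_def)
  have "(\<lambda>n. c n ^ k * P n) \<longlonglongrightarrow> limit_density k x"
  proof (cases "\<forall>i\<in>{1..k}. 0 \<le> x i")
    case False
    then obtain i where i: "i \<in> {1..k}" "x i < 0" by force
    have "c n ^ k * P n = 0" if n: "n \<ge> k" for n
    proof -
      have "c n * x i < 0" using i c_pos[of n] k n by (intro mult_pos_neg) auto
      then have "\<lfloor>c n * x i\<rfloor> + 1 \<le> 0" by linarith
      then have "cell {1..k} (c n) x i = 0" using i by (simp add: cell_def)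
      then have "cell {1..k} (c n) x \<notin> {1..k} \<rightarrow>\<^sub>E {1..}"
        using PiE_mem[of "cell {1..k} (c n) x" "{1..k}" "\<lambda>_. {1..}" i] i by auto
      then have "cell {1..k} (c n) x \<notin> set_pmf (map_pmf (block_lengths k) (random_game n))"
        using set_pmf_block_lengths_subset[OF n] by blast
      then show ?thesis by (simp add: P_def pmf_eq_0_set_pmf)
    qed
    then have "\<forall>\<^sub>F n in sequentially. c n ^ k * P n = 0"
      by (auto simp: eventually_sequentially)
    moreover have "limit_density k x = 0"
      unfolding limit_density_def using False by (simp only: if_False)
    ultimately show ?thesis by (simp add: tendsto_eventually)
  next
    case True
    define d where "d n = cell {1..k} (c n) x" for n
    define R where "R n j = (\<Sum>i=1..j. d n i)" for n j
    define s where "s j = (\<Sum>i=1..j. x i)" for j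
    have d_PiE: "d n \<in> {1..k} \<rightarrow>\<^sub>E {1..}" if "n \<ge> 1" for n
    proof -
      have "1 \<le> nat (\<lfloor>c n * x i\<rfloor> + 1)" if i: "i \<in> {1..k}" for i
      proof -
        have "0 \<le> c n * x i" using True i c_pos[OF \<open>n \<ge> 1\<close>] by simp
        then have "0 \<le> \<lfloor>c n * x i\<rfloor>" by simp
        then show ?thesis by linarith
      qed
      then show ?thesis by (auto simp: d_def cell_def)
    qed
    have d_lim: "(\<lambda>n. real (d n i) / c n) \<longlonglongrightarrow> x i" if "i \<in> {1..k}" for i
      using tendsto_scaled_floor[OF c_top, of "x i"] True that by (simp add: d_def cell_def)
    have R_lim: "(\<lambda>n. real (R n j) / c n) \<longlonglongrightarrow> s j" if "j \<le> k" for j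
    proof -
      have "(\<lambda>n. \<Sum>i=1..j. real (d n i) / c n) \<longlonglongrightarrow> s j"
        unfolding s_def using that by (intro tendsto_sum d_lim) auto
      then show ?thesis by (simp add: R_def sum_divide_distrib)
    qed
    have inv_c: "(\<lambda>n. a / c n) \<longlonglongrightarrow> 0" for a :: real
      by (intro tendsto_divide_0[OF tendsto_const] filterlim_at_top_imp_at_infinity c_top)
    have R_le: "\<forall>\<^sub>F n in sequentially. R n k \<le> n"
    proof -
      have "(\<lambda>n. real (R n k) / c n * (4 / c n)) \<longlonglongrightarrow> s k * 0"
        by (intro tendsto_mult R_lim inv_c order_refl)
      then have "\<forall>\<^sub>F n in sequentially. real (R n k) / c n * (4 / c n) < 1"
        by (rule order_tendstoD) simp
      then show ?thesis using eventually_ge_at_top[of 1]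
      proof eventually_elim
        case (elim n)
        have "c n * c n = 4 * real n" by (simp add: c_def)
        then have "real (R n k) / c n * (4 / c n) = real (R n k) / real n" by simp
        with elim(1) have "real (R n k) / real n < 1" by (simp only:)
        then show ?case using elim(2) by (simp add: divide_less_eq)
      qed
    qed
    have k_le_R: "k \<le> R n k" if "n \<ge> 1" for n
    proof -
      have "(\<Sum>i=1..k. 1) \<le> (\<Sum>i=1..k. d n i)"
        using d_PiE[OF that] by (intro sum_mono) (auto simp: PiE_iff)
      then show ?thesis by (simp add: R_def)
    qed
    define A where "A n = (\<Prod>i<R n k - k. 1 - real i / real n)" for n
    define B where "B n = (\<Prod>i<R n k. 1 - real i / (2 * real n))" for n
    have A_lim: "A \<longlonglongrightarrow> exp (- (2 * s k)\<^sup>2 / 2)"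
      unfolding A_def[abs_def]
    proof (rule tendsto_prod_one_minus)
      have "(\<lambda>n. 2 * (real (R n k) / c n - real k / c n)) \<longlonglongrightarrow> 2 * (s k - 0)"
        by (intro tendsto_intros R_lim inv_c order_refl)
      moreover have "\<forall>\<^sub>F n in sequentially.
          2 * (real (R n k) / c n - real k / c n) = real (R n k - k) / sqrt (real n)"
        using eventually_ge_at_top[of 1]
      proof eventually_elim
        case (elim n)
        then show ?case using k_le_R[OF elim] by (simp add: c_def of_nat_diff diff_divide_distrib)
      qed
      ultimately show "(\<lambda>n. real (R n k - k) / sqrt (real n)) \<longlonglongrightarrow> 2 * s k"
        by (auto intro: Lim_transform_eventually)
    qed (rule filterlim_real_sequentially)
    have B_lim: "B \<longlonglongrightarrow> exp (- (sqrt 2 * s k)\<^sup>2 / 2)"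
      unfolding B_def[abs_def]
    proof (rule tendsto_prod_one_minus)
      have "(\<lambda>n. sqrt 2 * (real (R n k) / c n)) \<longlonglongrightarrow> sqrt 2 * s k"
        by (intro tendsto_intros R_lim order_refl)
      moreover have "sqrt 2 * (real (R n k) / c n) = real (R n k) / sqrt (2 * real n)" for n
      proof -
        have "c n = sqrt 2 * sqrt (2 * real n)" by (simp add: c_def real_sqrt_mult)
        then show ?thesis by simp
      qed
      ultimately show "(\<lambda>n. real (R n k) / sqrt (2 * real n)) \<longlonglongrightarrow> sqrt 2 * s k" by simp
      show "filterlim (\<lambda>n. 2 * real n) at_top sequentially" by real_asymp
    qed
    have "(\<lambda>n. A n / B n) \<longlonglongrightarrow> exp (- (2 * s k)\<^sup>2 / 2) / exp (- (sqrt 2 * s k)\<^sup>2 / 2)"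
      by (intro tendsto_divide A_lim B_lim) simp
    also have "exp (- (2 * s k)\<^sup>2 / 2) / exp (- (sqrt 2 * s k)\<^sup>2 / 2) = exp (- (s k)\<^sup>2)"
      by (simp add: power_mult_distrib flip: exp_diff)
    finally have AB_lim: "(\<lambda>n. A n / B n) \<longlonglongrightarrow> exp (- (s k)\<^sup>2)" .
    have "(\<lambda>n. real (R n j) / c n + (1 - 2 * real j) / c n) \<longlonglongrightarrow> s j + 0" if "j \<le> k" for j
      using that by (intro tendsto_add R_lim inv_c)
    then have "(\<lambda>n. 2 ^ k * (\<Prod>j=1..k. real (R n j) / c n + (1 - 2 * real j) / c n) * (A n / B n))
        \<longlonglongrightarrow> 2 ^ k * (\<Prod>j=1..k. s j) * exp (- (s k)\<^sup>2)"
      by (intro tendsto_mult tendsto_const tendsto_prod AB_lim) simp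
    moreover have "\<forall>\<^sub>F n in sequentially.
        2 ^ k * (\<Prod>j=1..k. real (R n j) / c n + (1 - 2 * real j) / c n) * (A n / B n) = c n ^ k * P n"
      using R_le eventually_ge_at_top[of "max 1 k"]
    proof eventually_elim
      case (elim n)
      then have n: "1 \<le> n" "k \<le> n" by auto
      define Q where "Q = (\<Prod>j=1..k. real (R n j) - 2 * real j + 1)"
      have "c n * c n = 4 * real n" by (simp add: c_def)
      then have n_eq: "2 * real n = c n * c n / 2" by simp
      have "(\<Prod>j=1..k. real (R n j) / c n + (1 - 2 * real j) / c n)
          = (\<Prod>j=1..k. (real (R n j) - 2 * real j + 1) / c n)"
        by (intro prod.cong refl) (simp add: add_divide_distrib diff_divide_distrib)
      also have "\<dots> = Q / c n ^ k" by (simp add: Q_def prod_dividef)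
      finally have "2 ^ k * (\<Prod>j=1..k. real (R n j) / c n + (1 - 2 * real j) / c n)
          = c n ^ k * (Q / (2 * real n) ^ k)"
        using c_pos[OF n(1)] unfolding n_eq by (simp add: power_divide power_mult_distrib)
      moreover have "P n = Q / (2 * real n) ^ k * (A n / B n)"
        unfolding P_def d_def[symmetric] Q_def R_def A_def B_def
        by (rule pmf_block_lengths) (use n d_PiE elim in \<open>auto simp: R_def\<close>)
      ultimately show ?case by simp
    qed
    ultimately have "(\<lambda>n. c n ^ k * P n) \<longlonglongrightarrow> 2 ^ k * (\<Prod>j=1..k. s j) * exp (- (s k)\<^sup>2)"
      by (rule Lim_transform_eventually)
    moreover have "limit_density k x = 2 ^ k * (\<Prod>j=1..k. s j) * exp (- (s k)\<^sup>2)"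
      using True by (simp add: limit_density_def s_def)
    ultimately show ?thesis by simp
  qed
  then show ?thesis by (simp add: c_def P_def)
qed

theorem theorem5:
  fixes k :: nat
  assumes "k \<ge> 1"
  shows "prob_space (density (lebesgue_product k) (\<lambda>x. ennreal (limit_density k x))) \<and>
    (\<forall>(N :: 'b measure) X. prob_space N \<longrightarrow>
       distributed N (lebesgue_product k) X (\<lambda>x. ennreal (limit_density k x)) \<longrightarrow>
       converges_in_distribution (powertop_real {1..k})
         (\<lambda>n. measure_pmf (random_game n)) (scaled_block_lengths k) N X)"
proof (intro conjI allI impI prob_space_limit_density)
  fix N :: "'b measure" and X
  assume X: "distributed N (lebesgue_product k) X (\<lambda>x. ennreal (limit_density k x))"
  show "converges_in_distribution (powertop_real {1..k})
         (\<lambda>n. measure_pmf (random_game n)) (scaled_block_lengths k) N X"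
    unfolding converges_in_distribution_def
  proof (intro allI impI, elim conjE)
    fix g assume g: "continuous_map (powertop_real {1..k}) euclideanreal g"
      "bounded (g ` topspace (powertop_real {1..k}))"
    define p where "p n = map_pmf (block_lengths k) (random_game n)" for n
    define c where "c n = 2 * sqrt (real n)" for n
    \<comment> \<open>Games with fewer than \<open>k\<close> pairs have no \<open>k\<close>-th block, hence the shift by \<open>k\<close>.\<close>
    have "(\<lambda>n. \<integral>d. g (\<lambda>i\<in>{1..k}. real (d i) / c (n + k)) \<partial>p (n + k))
        \<longlonglongrightarrow> (\<integral>x. limit_density k x * g x \<partial>lebesgue_product k)"
    proof (rule local_limit_imp_weak_convergence)
      show "c (n + k) > 0" for n using assms by (simp add: c_def)
      show "filterlim (\<lambda>n. c (n + k)) at_top sequentially"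
        unfolding c_def by real_asymp
      show "finite (set_pmf (p (n + k)))" for n
        unfolding p_def set_pmf_block_lengths by (intro finite_imageI finite_games)
      show "set_pmf (p (n + k)) \<subseteq> {1..k} \<rightarrow>\<^sub>E {1..}" for n
        unfolding p_def by (rule set_pmf_block_lengths_subset) simp
      show "limit_density k x = 0" if "i \<in> {1..k}" "x i < 0" for x i
        using that by (force simp: limit_density_def)
      show "(\<lambda>n. c (n + k) ^ card {1..k} * pmf (p (n + k)) (cell {1..k} (c (n + k)) x))
          \<longlonglongrightarrow> limit_density k x" if "x \<in> extensional {1..k}" for x
        using LIMSEQ_ignore_initial_segment[OF local_limit_block_lengths[OF assms that], of k]
        by (simp add: c_def p_def)
    qed (simp_all only: g limit_density_measurable limit_density_nonneg nn_integral_limit_density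
          finite_atLeastAtMost)
    also have "(\<lambda>n. \<integral>d. g (\<lambda>i\<in>{1..k}. real (d i) / c (n + k)) \<partial>p (n + k))
        = (\<lambda>n. \<integral>\<omega>. g (scaled_block_lengths k (n + k) \<omega>) \<partial>random_game (n + k))"
    proof -
      have "scaled_block_lengths k m xs = (\<lambda>i\<in>{1..k}. real (block_lengths k xs i) / c m)" for m xs
        by (auto simp: scaled_block_lengths_def block_lengths_def c_def intro!: restrict_ext)
      then show ?thesis by (simp add: p_def integral_map_pmf)
    qed
    also have "(\<integral>x. limit_density k x * g x \<partial>lebesgue_product k) = (\<integral>\<omega>. g (X \<omega>) \<partial>N)"
      by (rule distributed_integral[OF X borel_measurable_powertop_real[OF g(1)] limit_density_nonneg])
    finally show "(\<lambda>n. \<integral>\<omega>. g (scaled_block_lengths k n \<omega>) \<partial>random_game n) \<longlonglongrightarrow> (\<integral>\<omega>. g (X \<omega>) \<partial>N)"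
      by (rule LIMSEQ_offset)
  qed
qed

end
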